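(* Let $L$ be a simple countable linear order of Hausdorff rank $1$. Then $L$ has a computable $\Pi_3$ Scott sentence, and $L$ has no Scott sentence (computable or not) that is $\Sigma_3$ or $d$-$\Sigma_\beta$ for some $\beta\leq 2$; i.e. $L$ has a computable $\Pi_3$ optimal Scott sentence.
   Context: Infinitary formulas of $L_{\omega_1\omega}$: $\Sigma_0=\Pi_0$ are finitary quantifier-free formulas; for $\alpha>0$, $\Sigma_\alpha$ formulas are countable disjunctions $\bigvee_i\exists\bar x\,\varphi_i$ with $\varphi_i$ $\Pi_\beta$, $\beta<\alpha$; $\Pi_\alpha$ formulas are countable conjunctions $\bigwedge_i\forall\bar x\,\varphi_i$ with $\varphi_i$ $\Sigma_\beta$, $\beta<\alpha$; $d$-$\Sigma_\alpha$ formulas are conjunctions of a $\Sigma_\alpha$ and a $\Pi_\alpha$ formula. A formula is computable if all its infinitary disjunctions and conjunctions are over c.e. sets of formulas. A Scott sentence of a countable structure $\mathcal A$ is an $L_{\omega_1\omega}$ sentence true in exactly the countable structures isomorphic to $\mathcal A$. A Scott sentence is optimal if $\mathcal A$ has no Scott sentence of strictly lower complexity in the order where $\Sigma_\beta,\Pi_\beta<d\text{-}\Sigma_\beta<\Sigma_{\beta+1},\Pi_{\beta+1}$. Hausdorff rank: $HR_0$ = finite linear orders (including empty); for $\alpha>0$, $HR_\alpha$ is the least class containing all $\sum_{i\in\zeta}L_i$ ($\zeta$ the integers) with $L_i\in\bigcup_{\beta<\alpha}HR_\beta$ and closed under finite sums; $r(L)$ = least $\alpha$ with $L\in HR_\alpha$.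 Simple: a linear order $L$ of Hausdorff rank $\alpha$ is simple if $L=\sum_{i\in\omega}L_i+\sum_{j\in\omega^*}L_j$ with $\lim_{i\to\omega}(r(L_i)+1)=\alpha$ or $\lim_{j\to\omega^*}(r(L_j)+1)=\alpha$.
   Formalization: In the definition of simple, all summands L_i and L_j are additionally required to have Hausdorff rank less than that of L; without this, ω+ω would be simple of rank 1 although it has no Π_3 Scott sentence. *)

theory Defs
  imports Complex_Main "HOL-Library.Nat_Bijection" "HOL-Library.Countable_Set"
begin

section \<open>Infinitary formulas in the language of orders\<close>

text \<open>
  Formulas of $L_{\omega_1\omega}$ over one binary relation symbol, with variables named by naturals.
  Countable disjunctions and conjunctions are indexed by the naturals; repetitions are allowed, so
  all nonempty countable families are covered (the empty ones amount to the finitary formulas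
  \<open>Neg Tru\<close> and \<open>Tru\<close>).
\<close>

datatype fm =
    Tru
  | Le nat nat
  | Eq nat nat
  | Neg fm
  | And fm fm
  | Or fm fm
  | Ex nat fm
  | All nat fm
  | BigOr "nat \<Rightarrow> fm"
  | BigAnd "nat \<Rightarrow> fm"

primrec fv :: "fm \<Rightarrow> nat set" where
  "fv Tru = {}"
| "fv (Le x y) = {x, y}"
| "fv (Eq x y) = {x, y}"
| "fv (Neg \<phi>) = fv \<phi>"
| "fv (And \<phi> \<psi>) = fv \<phi> \<union> fv \<psi>"
| "fv (Or \<phi> \<psi>) = fv \<phi> \<union> fv \<psi>"
| "fv (Ex x \<phi>) = fv \<phi> - {x}"
| "fv (All x \<phi>) = fv \<phi> - {x}"
| "fv (BigOr F) = (\<Union>n. fv (F n))"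
| "fv (BigAnd F) = (\<Union>n. fv (F n))"

text \<open>A structure is a (possibly empty) domain with a binary relation.\<close>

type_synonym 'a struc = "'a set \<times> 'a rel"

primrec sat :: "'a struc \<Rightarrow> fm \<Rightarrow> (nat \<Rightarrow> 'a) \<Rightarrow> bool" where
  "sat M Tru v \<longleftrightarrow> True"
| "sat M (Le x y) v \<longleftrightarrow> (v x, v y) \<in> snd M"
| "sat M (Eq x y) v \<longleftrightarrow> v x = v y"
| "sat M (Neg \<phi>) v \<longleftrightarrow> \<not> sat M \<phi> v"
| "sat M (And \<phi> \<psi>) v \<longleftrightarrow> sat M \<phi> v \<and> sat M \<psi> v"
| "sat M (Or \<phi> \<psi>) v \<longleftrightarrow> sat M \<phi> v \<or> sat M \<psi> v"
| "sat M (Ex x \<phi>) v \<longleftrightarrow> (\<exists>a\<in>fst M. sat M \<phi> (v(x := a)))"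
| "sat M (All x \<phi>) v \<longleftrightarrow> (\<forall>a\<in>fst M. sat M \<phi> (v(x := a)))"
| "sat M (BigOr F) v \<longleftrightarrow> (\<exists>n. sat M (F n) v)"
| "sat M (BigAnd F) v \<longleftrightarrow> (\<forall>n. sat M (F n) v)"

text \<open>
  Only used for sentences, whose truth value does not depend on the assignment; assignments are not
  required to take values in the domain, so that the empty structure is treated correctly.
\<close>

definition models :: "'a struc \<Rightarrow> fm \<Rightarrow> bool" where
  "models M \<phi> \<longleftrightarrow> (\<forall>v. sat M \<phi> v)"

definition isomorphic :: "'a struc \<Rightarrow> 'b struc \<Rightarrow> bool" where
  "isomorphic M N \<longleftrightarrow>
     (\<exists>f. bij_betw f (fst M) (fst N) \<and>
          (\<forall>x\<in>fst M. \<forall>y\<in>fst M. (x, y) \<in> snd M \<longleftrightarrow> (f x, f y) \<in> snd N))"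

lemma sat_iso:
  assumes "bij_betw f (fst M) (fst N)"
    and "\<forall>x\<in>fst M. \<forall>y\<in>fst M. (x, y) \<in> snd M \<longleftrightarrow> (f x, f y) \<in> snd N"
    and "\<forall>x\<in>fv \<phi>. v x \<in> fst M \<and> w x = f (v x)"
  shows "sat M \<phi> v \<longleftrightarrow> sat N \<phi> w"
  using assms(3)
proof (induction \<phi> arbitrary: v w)
  case (Eq x y)
  then show ?case using assms(1) by (auto simp: bij_betw_def dest: inj_onD)
next
  case (Ex x \<phi>)
  have *: "sat M \<phi> (v(x := a)) \<longleftrightarrow> sat N \<phi> (w(x := f a))" if "a \<in> fst M" for a
    using Ex.prems that by (intro Ex.IH) auto
  have "fst N = f ` fst M" using assms(1) by (simp add: bij_betw_def)
  then show ?case using * by simp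
next
  case (All x \<phi>)
  have *: "sat M \<phi> (v(x := a)) \<longleftrightarrow> sat N \<phi> (w(x := f a))" if "a \<in> fst M" for a
    using All.prems that by (intro All.IH) auto
  have "fst N = f ` fst M" using assms(1) by (simp add: bij_betw_def)
  then show ?case using * by simp
next
  case (BigOr F)
  have "sat M (F n) v \<longleftrightarrow> sat N (F n) w" for n using BigOr.prems by (intro BigOr.IH) auto
  then show ?case by simp
next
  case (BigAnd F)
  have "sat M (F n) v \<longleftrightarrow> sat N (F n) w" for n using BigAnd.prems by (intro BigAnd.IH) auto
  then show ?case by simp
next
  case (Neg \<phi>)
  have "sat M \<phi> v \<longleftrightarrow> sat N \<phi> w" using Neg.prems by (intro Neg.IH) simp
  then show ?case by simp
next
  case (And \<phi> \<psi>)
  have "sat M \<phi> v \<longleftrightarrow> sat N \<phi> w" "sat M \<psi> v \<longleftrightarrow> sat N \<psi> w"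
    using And.prems by (intro And.IH; simp)+
  then show ?case by simp
next
  case (Or \<phi> \<psi>)
  have "sat M \<phi> v \<longleftrightarrow> sat N \<phi> w" "sat M \<psi> v \<longleftrightarrow> sat N \<psi> w"
    using Or.prems by (intro Or.IH; simp)+
  then show ?case by simp
qed (use assms(2) in auto)

lemma models_iso:
  assumes "isomorphic M N" "fv \<phi> = {}"
  shows "models M \<phi> \<longleftrightarrow> models N \<phi>"
proof -
  obtain f where "sat M \<phi> v \<longleftrightarrow> sat N \<phi> w" for v w
    using assms sat_iso[of _ M N \<phi>] unfolding isomorphic_def by auto
  then show ?thesis unfolding models_def by blast
qed


section \<open>Complexity of formulas\<close>

inductive qfree :: "fm \<Rightarrow> bool" where
  "qfree Tru"
| "qfree (Le x y)"
| "qfree (Eq x y)"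
| "qfree \<phi> \<Longrightarrow> qfree (Neg \<phi>)"
| "qfree \<phi> \<Longrightarrow> qfree \<psi> \<Longrightarrow> qfree (And \<phi> \<psi>)"
| "qfree \<phi> \<Longrightarrow> qfree \<psi> \<Longrightarrow> qfree (Or \<phi> \<psi>)"

definition exs :: "nat list \<Rightarrow> fm \<Rightarrow> fm" where
  "exs xs \<phi> = foldr Ex xs \<phi>"

definition alls :: "nat list \<Rightarrow> fm \<Rightarrow> fm" where
  "alls xs \<phi> = foldr All xs \<phi>"

text \<open>
  Here and below ordinal indices range over an arbitrary well-ordered type, \<open>bot\<close> being the
  ordinal $0$. Each level refers to smaller ordinals only, so the type \<open>nat\<close> gives exactly the
  levels below $\omega$.
\<close>

inductive Sigma_fm :: "'o::{wellorder,order_bot} \<Rightarrow> fm \<Rightarrow> bool"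
  and Pi_fm :: "'o \<Rightarrow> fm \<Rightarrow> bool" where
  "qfree \<phi> \<Longrightarrow> Sigma_fm bot \<phi>"
| "qfree \<phi> \<Longrightarrow> Pi_fm bot \<phi>"
| "bot < \<alpha> \<Longrightarrow> \<forall>n. \<exists>\<beta><\<alpha>. Pi_fm \<beta> (G n) \<Longrightarrow> Sigma_fm \<alpha> (BigOr (\<lambda>n. exs (xs n) (G n)))"
| "bot < \<alpha> \<Longrightarrow> \<forall>n. \<exists>\<beta><\<alpha>. Sigma_fm \<beta> (G n) \<Longrightarrow> Pi_fm \<alpha> (BigAnd (\<lambda>n. alls (xs n) (G n)))"

inductive dSigma_fm :: "'o::{wellorder,order_bot} \<Rightarrow> fm \<Rightarrow> bool" where
  "Sigma_fm \<alpha> \<phi> \<Longrightarrow> Pi_fm \<alpha> \<psi> \<Longrightarrow> dSigma_fm \<alpha> (And \<phi> \<psi>)"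

datatype 'o complexity = CSigma 'o | CPi 'o | CdSigma 'o

primrec has_complexity :: "fm \<Rightarrow> 'o::{wellorder,order_bot} complexity \<Rightarrow> bool" where
  "has_complexity \<phi> (CSigma \<alpha>) \<longleftrightarrow> Sigma_fm \<alpha> \<phi>"
| "has_complexity \<phi> (CPi \<alpha>) \<longleftrightarrow> Pi_fm \<alpha> \<phi>"
| "has_complexity \<phi> (CdSigma \<alpha>) \<longleftrightarrow> dSigma_fm \<alpha> \<phi>"

inductive lower_complexity :: "'o::wellorder complexity \<Rightarrow> 'o complexity \<Rightarrow> bool" where
  "lower_complexity (CSigma \<beta>) (CdSigma \<beta>)"
| "lower_complexity (CPi \<beta>) (CdSigma \<beta>)"
| "\<beta> < \<gamma> \<Longrightarrow> lower_complexity (CdSigma \<beta>) (CSigma \<gamma>)"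
| "\<beta> < \<gamma> \<Longrightarrow> lower_complexity (CdSigma \<beta>) (CPi \<gamma>)"
| "lower_complexity c d \<Longrightarrow> lower_complexity d e \<Longrightarrow> lower_complexity c e"


section \<open>Scott sentences\<close>

text \<open>
  Every countable structure is isomorphic to one with domain a set of naturals, and truth of
  sentences is isomorphism invariant (\<open>models_iso\<close>), so quantifying over the latter covers all
  countable structures.
\<close>

definition scott_sentence :: "'a struc \<Rightarrow> fm \<Rightarrow> bool" where
  "scott_sentence A \<phi> \<longleftrightarrow>
     fv \<phi> = {} \<and> (\<forall>M :: nat struc. models M \<phi> \<longleftrightarrow> isomorphic M A)"

definition optimal_scott_sentence ::
    "'a struc \<Rightarrow> 'o::{wellorder,order_bot} complexity \<Rightarrow> fm \<Rightarrow> bool" where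
  "optimal_scott_sentence A c \<phi> \<longleftrightarrow>
     scott_sentence A \<phi> \<and> has_complexity \<phi> c \<and>
     \<not> (\<exists>d \<psi>. lower_complexity d c \<and> has_complexity \<psi> d \<and> scott_sentence A \<psi>)"


section \<open>Computable formulas\<close>

text \<open>
  Programs for the unary partial recursive functions: tuples are coded by the computable pairing
  function \<open>prod_encode\<close>; \<open>PRec\<close> is primitive recursion and \<open>Mu\<close> is unbounded minimisation.
\<close>

datatype prog =
    PZero
  | PSucc
  | PFst
  | PSnd
  | PPair prog prog
  | PComp prog prog
  | PRec prog prog
  | Mu prog

inductive computes :: "prog \<Rightarrow> nat \<Rightarrow> nat \<Rightarrow> bool" where
  "computes PZero x 0"
| "computes PSucc x (Suc x)"
| "computes PFst (prod_encode (x, y)) x"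
| "computes PSnd (prod_encode (x, y)) y"
| "computes p x y \<Longrightarrow> computes q x z \<Longrightarrow> computes (PPair p q) x (prod_encode (y, z))"
| "computes q x y \<Longrightarrow> computes p y z \<Longrightarrow> computes (PComp p q) x z"
| "computes p x y \<Longrightarrow> computes (PRec p q) (prod_encode (x, 0)) y"
| "computes (PRec p q) (prod_encode (x, n)) y \<Longrightarrow>
   computes q (prod_encode (x, prod_encode (n, y))) z \<Longrightarrow>
   computes (PRec p q) (prod_encode (x, Suc n)) z"
| "computes p (prod_encode (x, n)) 0 \<Longrightarrow>
   \<forall>m<n. \<exists>k. computes p (prod_encode (x, m)) (Suc k) \<Longrightarrow>
   computes (Mu p) x n"

primrec goedel :: "prog \<Rightarrow> nat" where
  "goedel PZero = prod_encode (0, 0)"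
| "goedel PSucc = prod_encode (1, 0)"
| "goedel PFst = prod_encode (2, 0)"
| "goedel PSnd = prod_encode (3, 0)"
| "goedel (PPair p q) = prod_encode (4, prod_encode (goedel p, goedel q))"
| "goedel (PComp p q) = prod_encode (5, prod_encode (goedel p, goedel q))"
| "goedel (PRec p q) = prod_encode (6, prod_encode (goedel p, goedel q))"
| "goedel (Mu p) = prod_encode (7, goedel p)"

text \<open>The c.e. set with index \<open>e\<close>, as the range of a partial recursive function.\<close>

definition W :: "nat \<Rightarrow> nat set" where
  "W e = {y. \<exists>p x. goedel p = e \<and> computes p x y}"

text \<open>
  \<open>codes c \<phi>\<close>: the number \<open>c\<close> is an index of the formula \<open>\<phi>\<close>. An index of an infinitary
  disjunction or conjunction contains an index of a c.e. set of indices of its members.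
\<close>

inductive codes :: "nat \<Rightarrow> fm \<Rightarrow> bool" where
  "codes (prod_encode (0, 0)) Tru"
| "codes (prod_encode (1, prod_encode (x, y))) (Le x y)"
| "codes (prod_encode (2, prod_encode (x, y))) (Eq x y)"
| "codes c \<phi> \<Longrightarrow> codes (prod_encode (3, c)) (Neg \<phi>)"
| "codes c \<phi> \<Longrightarrow> codes d \<psi> \<Longrightarrow> codes (prod_encode (4, prod_encode (c, d))) (And \<phi> \<psi>)"
| "codes c \<phi> \<Longrightarrow> codes d \<psi> \<Longrightarrow> codes (prod_encode (5, prod_encode (c, d))) (Or \<phi> \<psi>)"
| "codes c \<phi> \<Longrightarrow> codes (prod_encode (6, prod_encode (x, c))) (Ex x \<phi>)"
| "codes c \<phi> \<Longrightarrow> codes (prod_encode (7, prod_encode (x, c))) (All x \<phi>)"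
| "\<forall>c\<in>W e. \<exists>n. codes c (F n) \<Longrightarrow> \<forall>n. \<exists>c\<in>W e. codes c (F n) \<Longrightarrow>
   codes (prod_encode (8, e)) (BigOr F)"
| "\<forall>c\<in>W e. \<exists>n. codes c (F n) \<Longrightarrow> \<forall>n. \<exists>c\<in>W e. codes c (F n) \<Longrightarrow>
   codes (prod_encode (9, e)) (BigAnd F)"

definition computable_fm :: "fm \<Rightarrow> bool" where
  "computable_fm \<phi> \<longleftrightarrow> (\<exists>c. codes c \<phi>)"


section \<open>Hausdorff rank\<close>

text \<open>
  A linear order is a relation \<open>L\<close> with \<open>Linear_order L\<close> (so it is reflexive on its domain
  \<open>Field L\<close>); the empty relation is the empty order. Sums are taken of orders with pairwise
  disjoint domains. Hence on a fixed type the classes are automatically closed under isomorphism: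
  an order isomorphic to a sum is itself the sum of the images of the summands.
\<close>

definition lo_plus :: "'a rel \<Rightarrow> 'a rel \<Rightarrow> 'a rel \<Rightarrow> bool" where
  "lo_plus L1 L2 L \<longleftrightarrow>
     Field L1 \<inter> Field L2 = {} \<and> L = L1 \<union> L2 \<union> Field L1 \<times> Field L2"

text \<open>\<open>lt\<close> is the strict order of the index set, which is the whole index type.\<close>

definition lo_sum :: "('i \<Rightarrow> 'i \<Rightarrow> bool) \<Rightarrow> ('i \<Rightarrow> 'a rel) \<Rightarrow> 'a rel \<Rightarrow> bool" where
  "lo_sum lt Ls L \<longleftrightarrow>
     (\<forall>i j. i \<noteq> j \<longrightarrow> Field (Ls i) \<inter> Field (Ls j) = {}) \<and>
     L = (\<Union>i. Ls i) \<union> {(x, y). \<exists>i j. lt i j \<and> x \<in> Field (Ls i) \<and> y \<in> Field (Ls j)}"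

inductive HR :: "'o::{wellorder,order_bot} \<Rightarrow> 'a rel \<Rightarrow> bool" where
  "Linear_order L \<Longrightarrow> finite (Field L) \<Longrightarrow> HR bot L"
| "bot < \<alpha> \<Longrightarrow> \<forall>i. \<exists>\<beta><\<alpha>. HR \<beta> (Ls i) \<Longrightarrow> lo_sum ((<) :: int \<Rightarrow> int \<Rightarrow> bool) Ls L \<Longrightarrow> HR \<alpha> L"
| "bot < \<alpha> \<Longrightarrow> HR \<alpha> L1 \<Longrightarrow> HR \<alpha> L2 \<Longrightarrow> lo_plus L1 L2 L \<Longrightarrow> HR \<alpha> L"

definition has_hausdorff_rank :: "'a rel \<Rightarrow> 'o::{wellorder,order_bot} \<Rightarrow> bool" where
  "has_hausdorff_rank L \<alpha> \<longleftrightarrow> HR \<alpha> L \<and> (\<forall>\<beta><\<alpha>. \<not> HR \<beta> L)"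

definition osucc :: "'o::wellorder \<Rightarrow> 'o" where
  "osucc \<alpha> = (LEAST \<beta>. \<alpha> < \<beta>)"

text \<open>
  The summands \<open>A i\<close> (along $\omega$) and \<open>B j\<close> (along $\omega^*$) are required to have rank below
  \<open>\<alpha>\<close>, as in the definition of the Hausdorff rank. Without this $\omega + \omega$, whose second copy
  of $\omega$ could be taken as a single summand, would be simple of rank $1$. The limits are in
  the order topology of the ordinals.
\<close>

definition simple_lo ::
    "'o::{wellorder,order_bot,linorder_topology} \<Rightarrow> 'a rel \<Rightarrow> bool" where
  "simple_lo \<alpha> L \<longleftrightarrow>
     has_hausdorff_rank L \<alpha> \<and>
     (\<exists>A B L1 L2 a b.
        lo_sum ((<) :: nat \<Rightarrow> nat \<Rightarrow> bool) A L1 \<and>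
        lo_sum ((>) :: nat \<Rightarrow> nat \<Rightarrow> bool) B L2 \<and>
        lo_plus L1 L2 L \<and>
        (\<forall>i. has_hausdorff_rank (A i) (a i) \<and> a i < \<alpha>) \<and>
        (\<forall>j. has_hausdorff_rank (B j) (b j) \<and> b j < \<alpha>) \<and>
        ((\<lambda>i. osucc (a i)) \<longlonglongrightarrow> \<alpha> \<or> (\<lambda>j. osucc (b j)) \<longlonglongrightarrow> \<alpha>))"

end

theory Submission
  imports Defs
begin

text \<open>
  A simple order of rank 1 is infinite and each of its elements has finitely many predecessors or
  finitely many successors. Such an order is determined by the sets of lengths of its finite initial
  and of its finite final segments. That every element lies in a finite initial or final segment is a
  $\Pi_3$ sentence, and that there is a segment of a given length is a $\Sigma_2$ sentence, which gives
  the Scott sentence.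

  For the lower bound, let infinitely many elements have finitely many predecessors (otherwise reverse
  the order), and insert a copy of $\omega$ right after them. Every finite part of the new order is
  covered by an embedding of the old order which is the identity on any prescribed finite set of
  parameters. Hence $\Sigma_3$ and $\Pi_2$ sentences remain true, although the two orders are not
  isomorphic: the first new element has infinitely many predecessors and successors.
\<close>


section \<open>Computable functions and c.e. sets\<close>

text \<open>Preservation climbs one quantifier block at a time. An embedding carries Sigma_1 truths
  into the larger order. A universal block over the larger order names finitely many elements; an
  embedding that reaches them without moving the parameters lets the block be answered in the old
  order, so Pi_2 truths go up as well. The witnesses of a Sigma_3 sentence then act as the
  parameters. Hence the embeddings must vary, while one fixed map governs the parameters.

  Lengths of finite segments at an end are closed downwards, so the set of them is either all of the
  naturals or given by its maximum. The sentence hard-wires this finite information, which makes it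
  computable even when the order is not. The remaining work is uniformity: the codes of the members
  of each infinitary connective must come from one recursive function, and indices of nested c.e.
  sets from an s-m-n theorem.

  Infinity of the order is what keeps its two ends from overlapping, so that positions counted from
  either end determine it.\<close>

inductive_cases computesE:
  "computes PZero x y" "computes PSucc x y" "computes PFst x y" "computes PSnd x y"
  "computes (PPair p q) x y" "computes (PComp p q) x y"
  "computes (PRec p q) (prod_encode (x, 0)) y" "computes (PRec p q) (prod_encode (x, Suc n)) y"
  "computes (Mu p) x y"

lemma computes_fun:
  assumes "computes p x y" "computes p x z"
  shows "y = z"
  using assms
proof (induction arbitrary: z rule: computes.induct)
  case (3 x y)
  then show ?case by (auto elim: computesE(3))
next
  case (4 x y)
  then show ?case by (auto elim: computesE(4))
next
  case (5 p x y q w)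
  then show ?case by (metis computesE(5))
next
  case (6 q x y p w)
  then show ?case by (metis computesE(6))
next
  case (7 p x y q)
  then show ?case by (metis computesE(7))
next
  case (8 p q x n y w)
  then show ?case by (metis computesE(8))
next
  case (9 p x n)
  from 9(4) obtain *: "computes p (prod_encode (x, z)) 0"
    "\<forall>m<z. \<exists>k. computes p (prod_encode (x, m)) (Suc k)"
    by (rule computesE(9)) blast
  show ?case
  proof (rule linorder_cases[of n z])
    assume "n < z"
    then show ?thesis using *(2) "9.IH"(1) by (metis Zero_not_Suc)
  next
    assume "z < n"
    then show ?thesis using *(1) 9(3) by (metis Suc_not_Zero)
  qed
qed (blast elim: computesE)+

text \<open>\<open>W e\<close> collects the outputs of every program numbered \<open>e\<close>;
  injectivity leaves at most one such program.\<close>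

lemma goedel_inj: "goedel p = goedel q \<Longrightarrow> p = q"
  by (induction p arbitrary: q; case_tac q) auto

definition recf :: "(nat \<Rightarrow> nat) \<Rightarrow> bool" where
  "recf f \<longleftrightarrow> (\<exists>p. \<forall>x. computes p x (f x))"

abbreviation pf :: "nat \<Rightarrow> nat" where "pf n \<equiv> fst (prod_decode n)"
abbreviation ps :: "nat \<Rightarrow> nat" where "ps n \<equiv> snd (prod_decode n)"

lemma W_goedel:
  assumes "\<And>x. computes p x (f x)"
  shows "W (goedel p) = range f"
  unfolding W_def using assms computes_fun goedel_inj by blast

lemma recf_pf: "recf pf" and recf_ps: "recf ps"
  unfolding recf_def using computes.intros(3,4)
  by (metis prod.collapse prod_decode_inverse)+

lemma recf_zero: "recf (\<lambda>_. 0)" and recf_Suc: "recf Suc"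
  unfolding recf_def using computes.intros(1,2) by blast+

lemma recf_comp: "recf f \<Longrightarrow> recf g \<Longrightarrow> recf (\<lambda>x. f (g x))"
  unfolding recf_def using computes.intros(6) by meson

lemma recf_pair: "recf f \<Longrightarrow> recf g \<Longrightarrow> recf (\<lambda>x. prod_encode (f x, g x))"
  unfolding recf_def using computes.intros(5) by meson

lemma recf_id: "recf (\<lambda>x. x)"
  using recf_pair[OF recf_pf recf_ps] by simp

lemma recf_const: "recf (\<lambda>_. c)"
  by (induction c) (auto intro: recf_zero recf_comp[OF recf_Suc])

text \<open>\<open>PRec\<close> hands its step program the triple (parameter, (counter, previous
  value)); the argument of \<open>h\<close> is packed the same way and is unpacked below by
  \<open>pf\<close> and \<open>ps\<close>.\<close>

lemma recf_rec:
  assumes "recf g" "recf h" "recf a" "recf b"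
  shows "recf (\<lambda>x. rec_nat (g (a x)) (\<lambda>m y. h (prod_encode (a x, prod_encode (m, y)))) (b x))"
proof -
  obtain p q where pq: "\<And>x. computes p x (g x)" "\<And>x. computes q x (h x)"
    using assms(1,2) unfolding recf_def by blast
  have "computes (PRec p q) (prod_encode (c, n))
          (rec_nat (g c) (\<lambda>m y. h (prod_encode (c, prod_encode (m, y)))) n)" for c n
    by (induction n) (auto intro: computes.intros(7,8) pq)
  then have "recf (\<lambda>x. rec_nat (g (pf x)) (\<lambda>m y. h (prod_encode (pf x, prod_encode (m, y)))) (ps x))"
    unfolding recf_def by (metis prod.collapse prod_decode_inverse)
  from recf_comp[OF this recf_pair[OF assms(3,4)]] show ?thesis by simp
qed

text \<open>A recursion of length \<open>b x\<close> whose step discards the previous value gives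
  \<open>g x\<close> if no step is taken and \<open>h x\<close> otherwise.\<close>

lemma recf_if:
  assumes "recf g" "recf h" "recf b"
  shows "recf (\<lambda>x. if b x = 0 then g x else h x)"
proof -
  have "recf (\<lambda>x. rec_nat (g x) (\<lambda>m y. h (pf (prod_encode (x, prod_encode (m, y))))) (b x))"
    by (rule recf_rec[OF assms(1) recf_comp[OF assms(2) recf_pf] recf_id assms(3)])
  moreover have "rec_nat (g x) (\<lambda>m y. h (pf (prod_encode (x, prod_encode (m, y))))) n
      = (if n = 0 then g x else h x)" for n x
    by (cases n) auto
  ultimately show ?thesis by simp
qed

text \<open>The s-m-n theorem for these programs: \<open>n\<close> is built in by feeding
  \<open>p\<close> the pair of a numeral program for \<open>n\<close> and the identity program, and
  the number of the numeral program is primitive recursive in \<open>n\<close>.\<close>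

lemma recf_smn:
  assumes "recf f"
  shows "\<exists>g. recf g \<and> (\<forall>n. W (g n) = range (\<lambda>m. f (prod_encode (n, m))))"
proof -
  obtain p where p: "\<And>x. computes p x (f x)" using assms unfolding recf_def by blast
  define c where "c n = rec_nat PZero (\<lambda>_ q. PComp PSucc q) n" for n
  have c: "computes (c n) x n" for n x
    by (induction n) (auto simp: c_def intro: computes.intros)
  define i where "i = PPair PFst PSnd"
  have i: "computes i x x" for x
    unfolding i_def by (metis computes.intros(3-5) prod.collapse prod_decode_inverse)
  have "computes (PComp p (PPair (c n) i)) m (f (prod_encode (n, m)))" for n m
    using computes.intros(5,6) p c i by blast
  then have W: "W (goedel (PComp p (PPair (c n) i))) = range (\<lambda>m. f (prod_encode (n, m)))" for n
    by (rule W_goedel)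
  \<comment> \<open>The projections merely extract \<open>y\<close>; the term is written in the
    packed form of \<open>recf_rec\<close>, with 0 as a dummy parameter.\<close>
  have "goedel (c n) = rec_nat (prod_encode (0, 0))
      (\<lambda>m y. prod_encode (5, prod_encode (goedel PSucc,
         ps (ps (prod_encode (0, prod_encode (m, y))))))) n" for n
    by (induction n) (auto simp: c_def)
  then have "recf (\<lambda>n. goedel (c n))"
    using recf_rec[of "\<lambda>_. prod_encode (0, 0)"
        "\<lambda>x. prod_encode (5, prod_encode (goedel PSucc, ps (ps x)))" "\<lambda>_. 0" "\<lambda>x. x"]
    by (simp add: recf_const recf_id recf_pair recf_comp[OF recf_ps] recf_ps)
  then have "recf (\<lambda>n. goedel (PComp p (PPair (c n) i)))"
    by (simp add: recf_const recf_pair)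
  with W show ?thesis by blast
qed


section \<open>Uniformly computable families of formulas\<close>

text \<open>A coded infinitary formula requires a c.e. set of codes of its members, so computability
  of each member separately is not enough: one recursive function has to supply all codes.\<close>

definition ucomp :: "(nat \<Rightarrow> fm) \<Rightarrow> bool" where
  "ucomp F \<longleftrightarrow> (\<exists>f. recf f \<and> (\<forall>n. codes (f n) (F n)))"

lemma computable_fm_ucomp: "ucomp F \<Longrightarrow> computable_fm (F n)"
  unfolding ucomp_def computable_fm_def by blast

lemma ucompI: "recf f \<Longrightarrow> (\<And>n. codes (f n) (F n)) \<Longrightarrow> ucomp F"
  unfolding ucomp_def by blast

lemma ucompE:
  assumes "ucomp F" obtains f where "recf f" "\<And>n. codes (f n) (F n)"
  using assms unfolding ucomp_def by blast

lemma ucomp_comp: "ucomp F \<Longrightarrow> recf g \<Longrightarrow> ucomp (\<lambda>n. F (g n))"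
  by (erule ucompE, rule ucompI[OF recf_comp[where g = g]])

lemma ucomp_const: "codes c \<phi> \<Longrightarrow> ucomp (\<lambda>_. \<phi>)"
  unfolding ucomp_def using recf_const by blast

lemma ucomp_Tru: "ucomp (\<lambda>_. Tru)"
  by (rule ucomp_const) (rule codes.intros)

lemma ucomp_Le: "recf a \<Longrightarrow> recf b \<Longrightarrow> ucomp (\<lambda>n. Le (a n) (b n))"
  by (rule ucompI[OF recf_pair[OF recf_const recf_pair]]) (assumption | rule codes.intros)+

lemma ucomp_Eq: "recf a \<Longrightarrow> recf b \<Longrightarrow> ucomp (\<lambda>n. Eq (a n) (b n))"
  by (rule ucompI[OF recf_pair[OF recf_const recf_pair]]) (assumption | rule codes.intros)+

lemma ucomp_Neg: "ucomp F \<Longrightarrow> ucomp (\<lambda>n. Neg (F n))"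
  by (erule ucompE, rule ucompI[OF recf_pair[OF recf_const]]) (assumption | rule codes.intros)+

lemma ucomp_And: "ucomp F \<Longrightarrow> ucomp G \<Longrightarrow> ucomp (\<lambda>n. And (F n) (G n))"
  by (elim ucompE, rule ucompI[OF recf_pair[OF recf_const recf_pair]]) (assumption | rule codes.intros)+

lemma ucomp_Or: "ucomp F \<Longrightarrow> ucomp G \<Longrightarrow> ucomp (\<lambda>n. Or (F n) (G n))"
  by (elim ucompE, rule ucompI[OF recf_pair[OF recf_const recf_pair]]) (assumption | rule codes.intros)+

lemma ucomp_Ex: "recf a \<Longrightarrow> ucomp F \<Longrightarrow> ucomp (\<lambda>n. Ex (a n) (F n))"
  by (erule ucompE, rule ucompI[OF recf_pair[OF recf_const recf_pair]]) (assumption | rule codes.intros)+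

lemma ucomp_All: "recf a \<Longrightarrow> ucomp F \<Longrightarrow> ucomp (\<lambda>n. All (a n) (F n))"
  by (erule ucompE, rule ucompI[OF recf_pair[OF recf_const recf_pair]]) (assumption | rule codes.intros)+

text \<open>The members of the \<open>n\<close>-th formula have codes
  \<open>f (prod_encode (n, m))\<close>, and an index of the set of these is recursive in
  \<open>n\<close> by \<open>recf_smn\<close>.\<close>

lemma ucomp_Big:
  assumes "ucomp (\<lambda>n. F (pf n) (ps n))"
  shows ucomp_BigOr: "ucomp (\<lambda>n. BigOr (F n))" and ucomp_BigAnd: "ucomp (\<lambda>n. BigAnd (F n))"
proof -
  obtain f where f: "recf f" "\<And>n. codes (f n) (F (pf n) (ps n))"
    using assms unfolding ucomp_def by blast
  obtain g where g: "recf g" "\<And>n. W (g n) = range (\<lambda>m. f (prod_encode (n, m)))"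
    using recf_smn[OF f(1)] by blast
  have fc: "codes (f (prod_encode (n, m))) (F n m)" for n m
    using f(2)[of "prod_encode (n, m)"] by simp
  have in_W: "\<forall>c\<in>W (g n). \<exists>k. codes c (F n k)" "\<forall>k. \<exists>c\<in>W (g n). codes c (F n k)" for n
    using fc unfolding g(2) by blast+
  have "codes (prod_encode (8, g n)) (BigOr (F n))" "codes (prod_encode (9, g n)) (BigAnd (F n))" for n
    by (rule codes.intros(9,10)[OF in_W])+
  moreover have "recf (\<lambda>n. prod_encode (8, g n))" "recf (\<lambda>n. prod_encode (9, g n))"
    by (simp_all add: recf_pair recf_const g)
  ultimately show "ucomp (\<lambda>n. BigOr (F n))" "ucomp (\<lambda>n. BigAnd (F n))"
    unfolding ucomp_def by blast+
qed

lemma ucomp_if: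
  assumes "ucomp F" "ucomp G" "recf b"
  shows "ucomp (\<lambda>n. if b n = 0 then F n else G n)"
proof -
  obtain f g where fg: "recf f" "\<And>n. codes (f n) (F n)" "recf g" "\<And>n. codes (g n) (G n)"
    using assms unfolding ucomp_def by blast
  have "recf (\<lambda>n. if b n = 0 then f n else g n)" by (rule recf_if) (fact fg assms)+
  with fg show ?thesis unfolding ucomp_def by (intro exI[of _ "\<lambda>n. if b n = 0 then f n else g n"]) simp
qed

text \<open>\<open>H\<close> builds formulas and \<open>h\<close> their codes: recursion on formulas
  is shadowed by primitive recursion on codes.\<close>

lemma ucomp_rec:
  assumes "ucomp F" "recf h"
    and step: "\<And>a m c \<phi>. codes c \<phi> \<Longrightarrow> codes (h (prod_encode (a, prod_encode (m, c)))) (H a m \<phi>)"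
    and "recf a" "recf b"
  shows "ucomp (\<lambda>n. rec_nat (F (a n)) (H (a n)) (b n))"
proof -
  obtain f where f: "recf f" "\<And>n. codes (f n) (F n)"
    using assms unfolding ucomp_def by blast
  have "codes (rec_nat (f x) (\<lambda>m y. h (prod_encode (x, prod_encode (m, y)))) n)
          (rec_nat (F x) (H x) n)" for x n
    by (induction n) (auto intro: f step)
  then show ?thesis unfolding ucomp_def using recf_rec[OF f(1) assms(2,4,5)] by blast
qed

text \<open>Two families must be merged inside one \<open>BigAnd\<close> or \<open>BigOr\<close>,
  since the Sigma and Pi levels admit binary connectives in quantifier-free formulas only. Just the
  range matters, so repetitions are harmless.\<close>

definition join :: "(nat \<Rightarrow> 'b) \<Rightarrow> (nat \<Rightarrow> 'b) \<Rightarrow> nat \<Rightarrow> 'b" where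
  "join F G n = (if ps n = 0 then F (pf n) else G (pf n))"

lemma range_join: "range (join F G) = range F \<union> range G"
proof (intro equalityI Un_least image_subsetI)
  show "F m \<in> range (join F G)" for m
    by (rule range_eqI[of _ _ "prod_encode (m, 0)"]) (simp add: join_def)
  show "G m \<in> range (join F G)" for m
    by (rule range_eqI[of _ _ "prod_encode (m, 1)"]) (simp add: join_def)
qed (simp add: join_def)

lemma ucomp_join: "ucomp F \<Longrightarrow> ucomp G \<Longrightarrow> ucomp (join F G)"
  using ucomp_if[OF ucomp_comp[OF _ recf_pf] ucomp_comp[OF _ recf_pf] recf_ps]
  unfolding join_def[abs_def] .


section \<open>Finite positions in a linear order\<close>

text \<open>Everything is relative to \<open>D\<close>, because the relation of a structure may also
  relate points outside its domain.\<close>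

definition lin :: "'a set \<Rightarrow> 'a rel \<Rightarrow> bool" where
  "lin D r \<longleftrightarrow> (\<forall>x\<in>D. (x, x) \<in> r) \<and>
     (\<forall>x\<in>D. \<forall>y\<in>D. \<forall>z\<in>D. (x, y) \<in> r \<longrightarrow> (y, z) \<in> r \<longrightarrow> (x, z) \<in> r) \<and>
     (\<forall>x\<in>D. \<forall>y\<in>D. (x, y) \<in> r \<longrightarrow> (y, x) \<in> r \<longrightarrow> x = y) \<and>
     (\<forall>x\<in>D. \<forall>y\<in>D. (x, y) \<in> r \<or> (y, x) \<in> r)"

definition below :: "'a set \<Rightarrow> 'a rel \<Rightarrow> 'a \<Rightarrow> 'a set" where
  "below D r x = {z \<in> D. (z, x) \<in> r \<and> z \<noteq> x}"

text \<open>Finiteness is demanded separately because an infinite set has \<open>card\<close> 0 and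
  would otherwise yield position 0.\<close>

definition pos_at :: "'a set \<Rightarrow> 'a rel \<Rightarrow> nat \<Rightarrow> 'a \<Rightarrow> bool" where
  "pos_at D r j x \<longleftrightarrow> x \<in> D \<and> finite (below D r x) \<and> card (below D r x) = j"

definition two_ended :: "'a set \<Rightarrow> 'a rel \<Rightarrow> bool" where
  "two_ended D r \<longleftrightarrow> (\<forall>x\<in>D. finite (below D r x) \<or> finite (below D (r\<inverse>) x))"

lemma lin_converse: "lin D r \<Longrightarrow> lin D (r\<inverse>)"
  unfolding lin_def converse_iff by blast

lemma lin_refl: "lin D r \<Longrightarrow> x \<in> D \<Longrightarrow> (x, x) \<in> r"
  and lin_trans: "lin D r \<Longrightarrow> x \<in> D \<Longrightarrow> y \<in> D \<Longrightarrow> z \<in> D \<Longrightarrow> (x, y) \<in> r \<Longrightarrow> (y, z) \<in> r \<Longrightarrow> (x, z) \<in> r"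
  and lin_antisym: "lin D r \<Longrightarrow> x \<in> D \<Longrightarrow> y \<in> D \<Longrightarrow> (x, y) \<in> r \<Longrightarrow> (y, x) \<in> r \<Longrightarrow> x = y"
  and lin_total: "lin D r \<Longrightarrow> x \<in> D \<Longrightarrow> y \<in> D \<Longrightarrow> (x, y) \<in> r \<or> (y, x) \<in> r"
  unfolding lin_def by blast+

lemma lin_Linear_order:
  assumes "Linear_order r"
  shows "lin (Field r) r"
proof -
  have "refl_on (Field r) r" "trans r" "antisym r" "total_on (Field r) r"
    using assms by (simp_all add: order_on_defs)
  then show ?thesis unfolding lin_def
  proof (intro conjI ballI impI)
    fix x y assume "x \<in> Field r" "y \<in> Field r"
    then show "(x, y) \<in> r \<or> (y, x) \<in> r"
      using \<open>refl_on (Field r) r\<close> \<open>total_on (Field r) r\<close> by (cases "x = y") (auto simp: total_on_def dest: refl_onD)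
  qed (auto dest: refl_onD transD antisymD)
qed

lemma below_psubset:
  assumes "lin D r" "x \<in> D" "y \<in> D" "(x, y) \<in> r" "x \<noteq> y"
  shows "below D r x \<subset> below D r y"
proof -
  have "x \<in> below D r y" "x \<notin> below D r x" using assms by (auto simp: below_def)
  moreover have "below D r x \<subseteq> below D r y"
    unfolding below_def using assms lin_trans[OF assms(1)] lin_antisym[OF assms(1)] by blast
  ultimately show ?thesis by blast
qed

lemma pos_at_less:
  assumes "lin D r" "pos_at D r i x" "pos_at D r j y" "(x, y) \<in> r" "x \<noteq> y"
  shows "i < j"
  using assms below_psubset[of D r x y] psubset_card_mono unfolding pos_at_def by metis

lemma pos_at_unique:
  assumes "lin D r" "pos_at D r i x" "pos_at D r i y"
  shows "x = y"
proof (rule ccontr)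
  assume "x \<noteq> y"
  moreover have "(x, y) \<in> r \<or> (y, x) \<in> r" using lin_total assms unfolding pos_at_def by metis
  ultimately show False using pos_at_less assms by (metis less_irrefl)
qed

lemma pos_at_le_iff:
  assumes "lin D r" "pos_at D r i x" "pos_at D r j y"
  shows "(x, y) \<in> r \<longleftrightarrow> i \<le> j"
proof
  assume "(x, y) \<in> r"
  then show "i \<le> j" using pos_at_less[OF assms] assms(2,3) unfolding pos_at_def by (cases "x = y") auto
next
  assume *: "i \<le> j"
  show "(x, y) \<in> r"
  proof (cases "x = y")
    case True
    then show ?thesis using lin_refl[OF assms(1)] assms(2) by (simp add: pos_at_def)
  next
    case False
    then have "(y, x) \<notin> r" using pos_at_less[OF assms(1,3,2)] * by fastforce
    then show ?thesis using lin_total[OF assms(1)] assms(2,3) unfolding pos_at_def by blast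
  qed
qed

text \<open>Among the finitely many predecessors of \<open>x\<close>, one with the most predecessors
  of its own is the immediate predecessor.\<close>

lemma pos_at_pred:
  assumes "lin D r" "pos_at D r (Suc j) x"
  shows "\<exists>y. pos_at D r j y"
proof -
  let ?S = "below D r x"
  have S: "finite ?S" "card ?S = Suc j" "x \<in> D" using assms(2) by (auto simp: pos_at_def)
  have fin: "finite (below D r z)" if "z \<in> ?S" for z
    using below_psubset[OF assms(1), of z x] that S finite_subset unfolding below_def by blast
  have "finite ((\<lambda>z. card (below D r z)) ` ?S)" "(\<lambda>z. card (below D r z)) ` ?S \<noteq> {}" using S by auto
  from Max_in[OF this] obtain m where m: "m \<in> ?S"
    "card (below D r m) = Max ((\<lambda>z. card (below D r z)) ` ?S)" by auto
  then have max: "card (below D r z) \<le> card (below D r m)" if "z \<in> ?S" for z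
    using that S by simp
  have mD: "m \<in> D" using m by (simp add: below_def)
  have "?S = insert m (below D r m)"
  proof (intro equalityI subsetI)
    fix z assume z: "z \<in> ?S"
    then have zD: "z \<in> D" by (simp add: below_def)
    have "\<not> ((m, z) \<in> r \<and> m \<noteq> z)"
      using below_psubset[OF assms(1) mD zD] psubset_card_mono[OF fin[OF z]] max[OF z] by (meson leD)
    then show "z \<in> insert m (below D r m)"
      using lin_total[OF assms(1) mD zD] zD by (auto simp: below_def)
  next
    fix z assume "z \<in> insert m (below D r m)"
    then show "z \<in> ?S" using m(1) below_psubset[OF assms(1) mD S(3)] by (auto simp: below_def)
  qed
  moreover have "m \<notin> below D r m" by (simp add: below_def)
  ultimately have "card ?S = Suc (card (below D r m))" using fin[OF m(1)] by simp
  then show ?thesis using S(2) fin[OF m(1)] mD by (auto simp: pos_at_def)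
qed

lemma pos_at_down:
  assumes "lin D r" "i \<le> j" "\<exists>x. pos_at D r j x"
  shows "\<exists>y. pos_at D r i y"
  using assms(2,3) by (induction rule: inc_induct) (use pos_at_pred[OF assms(1)] in blast)+

text \<open>\<open>y\<close> lists the first \<open>k\<close> elements by repeatedly taking the
  least one not yet listed. This form uses a single universal quantifier over a quantifier-free
  matrix, which keeps \<open>seg_fm\<close> at Sigma_2.\<close>

definition seg :: "'a set \<Rightarrow> 'a rel \<Rightarrow> nat \<Rightarrow> (nat \<Rightarrow> 'a) \<Rightarrow> bool" where
  "seg D r k y \<longleftrightarrow> (\<forall>i<k. y i \<in> D \<and> y i \<notin> y ` {..<i} \<and> (\<forall>z\<in>D. z \<in> y ` {..<i} \<or> (y i, z) \<in> r))"

text \<open>Taking least remaining elements makes the predecessors of \<open>y i\<close> exactly the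
  earlier entries. Conversely, a predecessor of \<open>y i\<close> has a position below
  \<open>i\<close>, and uniqueness of positions shows that it is already listed.\<close>

lemma seg_pos_at:
  assumes "lin D r"
  shows "seg D r k y \<longleftrightarrow> (\<forall>i<k. pos_at D r i (y i))"
proof
  assume y: "seg D r k y"
  show "\<forall>i<k. pos_at D r i (y i)"
  proof (intro allI impI)
    fix i assume i: "i < k"
    have less: "y j \<in> below D r (y i)" if "j < i" for j
    proof -
      \<comment> \<open>At stage \<open>j\<close> the element \<open>y i\<close> is not yet listed,
        so minimality of \<open>y j\<close> applies to it.\<close>
      have "y i \<notin> y ` {..<j}" "y i \<noteq> y j" using y i that unfolding seg_def by fastforce+
      then show ?thesis using y i that unfolding seg_def below_def
        by (metis (mono_tags, lifting) less_trans mem_Collect_eq)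
    qed
    have "z \<in> y ` {..<i}" if "z \<in> below D r (y i)" for z
    proof -
      have "z \<in> y ` {..<i} \<or> (y i, z) \<in> r" using that i y unfolding seg_def below_def by blast
      then show ?thesis using that lin_antisym[OF assms, of z "y i"] y i
        unfolding below_def seg_def by blast
    qed
    with less have "below D r (y i) = y ` {..<i}" by blast
    moreover have "inj_on y {..<i}"
    proof (rule linorder_inj_onI)
      fix a b assume "a < b" "a \<in> {..<i}" "b \<in> {..<i}"
      then show "y a \<noteq> y b" using y i unfolding seg_def by (metis imageI lessThan_iff less_trans)
    qed auto
    ultimately show "pos_at D r i (y i)"
      using y i unfolding pos_at_def seg_def by (simp add: card_image)
  qed
next
  assume y: "\<forall>i<k. pos_at D r i (y i)"
  have "z \<in> y ` {..<i} \<or> (y i, z) \<in> r" if i: "i < k" and z: "z \<in> D" for i z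
  proof (cases "(y i, z) \<in> r")
    case False
    have yi: "y i \<in> D" "finite (below D r (y i))" "card (below D r (y i)) = i"
      using y i by (auto simp: pos_at_def)
    have "(z, y i) \<in> r" "z \<noteq> y i" using False lin_total[OF assms yi(1) z] lin_refl[OF assms yi(1)] by auto
    then have sub: "below D r z \<subset> below D r (y i)" by (rule below_psubset[OF assms z yi(1)])
    then have "pos_at D r (card (below D r z)) z"
      using z finite_subset[OF psubset_imp_subset yi(2)] by (simp add: pos_at_def)
    moreover have "card (below D r z) < i" using psubset_card_mono[OF yi(2) sub] yi(3) by simp
    moreover from this have "pos_at D r (card (below D r z)) (y (card (below D r z)))" using y i by simp
    ultimately have "z = y (card (below D r z))" by (intro pos_at_unique[OF assms])
    with \<open>card (below D r z) < i\<close> show ?thesis by (metis imageI lessThan_iff)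
  qed simp
  moreover have "y i \<notin> y ` {..<i}" if "i < k" for i
  proof
    assume "y i \<in> y ` {..<i}"
    then obtain j where "j < i" "y i = y j" by blast
    with y that show False unfolding pos_at_def by (metis less_trans nat_neq_iff)
  qed
  ultimately show "seg D r k y" using y unfolding seg_def pos_at_def by blast
qed

lemma ex_seg_iff:
  assumes "lin D r"
  shows "(\<exists>y. seg D r k y) \<longleftrightarrow> (\<forall>i<k. \<exists>x. pos_at D r i x)"
  unfolding seg_pos_at[OF assms] by metis

text \<open>Finiteness becomes a countable disjunction over lengths \<open>k\<close>, the one that
  the formulas \<open>near_end\<close> express.\<close>

lemma finite_below_iff:
  assumes "lin D r" "x \<in> D"
  shows "finite (below D r x) \<longleftrightarrow> (\<exists>k y. seg D r k y \<and> (\<exists>i<k. x = y i))"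
proof
  assume fin: "finite (below D r x)"
  define k where "k = card (below D r x)"
  have x: "pos_at D r k x" using fin assms by (simp add: pos_at_def k_def)
  then have "\<forall>i<Suc k. \<exists>x. pos_at D r i x" using pos_at_down[OF assms(1)] by (metis less_Suc_eq_le)
  then obtain y where y: "seg D r (Suc k) y" using ex_seg_iff[OF assms(1)] by blast
  then have "x = y k" using x pos_at_unique[OF assms(1)] unfolding seg_pos_at[OF assms(1)] by blast
  with y show "\<exists>k y. seg D r k y \<and> (\<exists>i<k. x = y i)" by blast
next
  assume "\<exists>k y. seg D r k y \<and> (\<exists>i<k. x = y i)"
  then show "finite (below D r x)" unfolding seg_pos_at[OF assms(1)] pos_at_def by blast
qed

section \<open>Recovering an infinite two-ended order from its occupied positions\<close>

definition at_end :: "bool \<Rightarrow> 'a rel \<Rightarrow> 'a rel" where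
  "at_end d r = (if d then r else r\<inverse>)"

lemma lin_at_end: "lin D r \<Longrightarrow> lin D (at_end d r)"
  by (simp add: at_end_def lin_converse)

text \<open>If \<open>x\<close> were at most \<open>y\<close>, every element would be at most
  \<open>y\<close> or at least \<open>x\<close>, making \<open>D\<close> a union of two finite
  sets.\<close>

lemma infinite_not_both_ends:
  assumes "lin D r" "infinite D" "x \<in> D" "y \<in> D" "finite (below D r y)" "finite (below D (r\<inverse>) x)"
  shows "(x, y) \<notin> r"
proof
  assume xy: "(x, y) \<in> r"
  have "D \<subseteq> insert y (below D r y) \<union> insert x (below D (r\<inverse>) x)"
  proof
    fix z assume z: "z \<in> D"
    then have "(z, y) \<in> r \<or> (x, z) \<in> r"
      using lin_total[OF assms(1)] lin_trans[OF assms(1)] assms(3,4) xy by blast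
    then show "z \<in> insert y (below D r y) \<union> insert x (below D (r\<inverse>) x)"
      using z by (auto simp: below_def)
  qed
  with assms show False by (meson finite_UnI finite_insert finite_subset)
qed

text \<open>Elements at the same position from the same end are matched. Positions determine the
  order within an end; comparisons across ends are forced, since in an infinite order the left part
  lies entirely before the right part.\<close>

lemma positions_isomorphic:
  assumes D: "lin D r" "two_ended D r" "infinite D" and E: "lin E s" "two_ended E s"
    and pos: "\<And>d j. (\<exists>x. pos_at D (at_end d r) j x) \<longleftrightarrow> (\<exists>x. pos_at E (at_end d s) j x)"
  shows "isomorphic (D, r) (E, s)"
proof -
  define A where "A d = {x. \<exists>j. pos_at D (at_end d r) j x}" for d
  define B where "B d = {x. \<exists>j. pos_at E (at_end d s) j x}" for d
  define f where "f d x = (THE y. \<exists>j. pos_at D (at_end d r) j x \<and> pos_at E (at_end d s) j y)" for d x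
  have lin: "lin D (at_end d r)" "lin E (at_end d s)" for d using D E by (simp_all add: lin_at_end)
  have f: "\<exists>j. pos_at D (at_end d r) j x \<and> pos_at E (at_end d s) j (f d x)" if x: "x \<in> A d" for d x
  proof -
    obtain j where j: "pos_at D (at_end d r) j x" using x by (auto simp: A_def)
    then obtain y where y: "pos_at E (at_end d s) j y" using pos by blast
    have "f d x = y" unfolding f_def
    proof (rule the_equality)
      show "\<exists>j. pos_at D (at_end d r) j x \<and> pos_at E (at_end d s) j y" using j y by blast
    next
      fix y' assume "\<exists>j. pos_at D (at_end d r) j x \<and> pos_at E (at_end d s) j y'"
      then obtain i where i: "pos_at D (at_end d r) i x" "pos_at E (at_end d s) i y'" by blast
      with j have "i = j" by (simp add: pos_at_def)
      with i y show "y' = y" using pos_at_unique[OF lin(2)] by blast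
    qed
    with j y show ?thesis by blast
  qed
  have bij: "bij_betw (f d) (A d) (B d)" for d
    unfolding bij_betw_def
  proof (intro conjI inj_onI equalityI subsetI)
    fix x x' assume "x \<in> A d" "x' \<in> A d" and eq: "f d x = f d x'"
    with f obtain j j' where "pos_at D (at_end d r) j x" "pos_at E (at_end d s) j (f d x)"
      "pos_at D (at_end d r) j' x'" "pos_at E (at_end d s) j' (f d x)" by metis
    then show "x = x'" using pos_at_unique[OF lin(1)] by (metis pos_at_def)
  next
    fix y assume "y \<in> f d ` A d"
    then show "y \<in> B d" using f unfolding B_def by blast
  next
    fix y assume "y \<in> B d"
    then obtain j where j: "pos_at E (at_end d s) j y" by (auto simp: B_def)
    then obtain x where x: "pos_at D (at_end d r) j x" using pos by blast
    then have "x \<in> A d" by (auto simp: A_def)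
    from f[OF this] x j have "f d x = y" using pos_at_unique[OF lin(2)] by (metis pos_at_def)
    with \<open>x \<in> A d\<close> show "y \<in> f d ` A d" by blast
  qed
  have DA: "D = A True \<union> A False" and EB: "E = B True \<union> B False"
    using D(2) E(2) by (auto simp: A_def B_def pos_at_def at_end_def two_ended_def)
  \<comment> \<open>The bijections carry infinity over to \<open>E\<close>, so its ends are
    separated as well.\<close>
  have "infinite (A True) \<or> infinite (A False)" using D(3) DA by simp
  then have "infinite (B True) \<or> infinite (B False)" using bij bij_betw_finite by blast
  then have infE: "infinite E" using EB by auto
  have memA: "finite (below D (at_end d r) x)" "x \<in> D" if "x \<in> A d" for d x
    using that by (auto simp: A_def pos_at_def)
  have memB: "finite (below E (at_end d s) x)" "x \<in> E" if "x \<in> B d" for d x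
    using that by (auto simp: B_def pos_at_def)
  note memA1 = memA[of _ True, unfolded at_end_def, simplified] and memA2 = memA[of _ False, unfolded at_end_def, simplified]
  note memB1 = memB[of _ True, unfolded at_end_def, simplified] and memB2 = memB[of _ False, unfolded at_end_def, simplified]
  have crossD: "(x, y) \<notin> r" if "x \<in> A False" "y \<in> A True" for x y
    using infinite_not_both_ends[OF D(1,3)] memA1 memA2 that by blast
  have crossE: "(x, y) \<notin> s" if "x \<in> B False" "y \<in> B True" for x y
    using infinite_not_both_ends[OF E(1) infE] memB1 memB2 that by blast
  have disjA: "A True \<inter> A False = {}" using crossD lin_refl[OF D(1)] memA1 by blast
  have disjB: "B True \<inter> B False = {}" using crossE lin_refl[OF E(1)] memB1 by blast
  define g where "g x = (if x \<in> A True then f True x else f False x)" for x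
  have gT: "g x = f True x" if "x \<in> A True" for x using that by (simp add: g_def)
  have gF: "g x = f False x" if "x \<in> A False" for x using that disjA by (auto simp: g_def)
  have "bij_betw g (A True) (B True)" "bij_betw g (A False) (B False)"
    using bij bij_betw_cong[of "A True" g "f True"] bij_betw_cong[of "A False" g "f False"] gT gF by blast+
  then have bijg: "bij_betw g D E" unfolding DA EB using disjB by (rule bij_betw_combine)
  have fB: "f d x \<in> B d" if "x \<in> A d" for d x using bij that by (auto simp: bij_betw_def)
  have same: "(x, y) \<in> at_end d r \<longleftrightarrow> (f d x, f d y) \<in> at_end d s" if "x \<in> A d" "y \<in> A d" for d x y
    using f[OF that(1)] f[OF that(2)] pos_at_le_iff[OF lin(1)] pos_at_le_iff[OF lin(2)] by blast
  have "(x, y) \<in> r \<longleftrightarrow> (g x, g y) \<in> s" if xy: "x \<in> D" "y \<in> D" for x y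
  proof -
    consider "x \<in> A True" "y \<in> A True" | "x \<in> A False" "y \<in> A False"
      | "x \<in> A False" "y \<in> A True" | "x \<in> A True" "y \<in> A False" using xy DA by blast
    then show ?thesis
    proof cases
      case 1
      then show ?thesis using same[of x True y] by (simp add: gT at_end_def)
    next
      case 2
      \<comment> \<open>The arguments are swapped because \<open>at_end False\<close> reverses the
        order.\<close>
      then show ?thesis using same[of y False x] by (simp add: gF at_end_def)
    next
      case 3
      then show ?thesis using crossD crossE fB by (simp add: gT gF)
    next
      case 4
      then have "(y, x) \<notin> r" "(g y, g x) \<notin> s" using crossD crossE fB by (simp_all add: gT gF)
      moreover have "g x \<in> E" "g y \<in> E" using bijg xy by (auto simp: bij_betw_def)
      ultimately show ?thesis using lin_total[OF D(1)] lin_total[OF E(1)] xy by blast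
    qed
  qed
  with bijg show ?thesis unfolding isomorphic_def by auto
qed


section \<open>Quantifier blocks\<close>

text \<open>Describing the block by one final assignment \<open>u\<close> avoids requiring distinct
  variables in \<open>xs\<close>: for a repeated one the innermost value counts.\<close>

lemma sat_exs:
  "sat M (exs xs \<phi>) v \<longleftrightarrow>
     (\<exists>u. (\<forall>x\<in>set xs. u x \<in> fst M) \<and> (\<forall>x. x \<notin> set xs \<longrightarrow> u x = v x) \<and> sat M \<phi> u)"
proof (induction xs arbitrary: v)
  case Nil
  have "u = v" if "\<forall>x. u x = v x" for u using that by blast
  then show ?case by (auto simp: exs_def)
next
  case (Cons a xs)
  show ?case (is "?l \<longleftrightarrow> ?r")
  proof
    assume ?l
    then obtain b where b: "b \<in> fst M" "sat M (exs xs \<phi>) (v(a := b))" by (auto simp: exs_def)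
    from this(2) Cons obtain u where u: "\<forall>x\<in>set xs. u x \<in> fst M"
      "\<forall>x. x \<notin> set xs \<longrightarrow> u x = (v(a := b)) x" "sat M \<phi> u" by blast
    have "u a \<in> fst M" using u(1,2) b(1) by (cases "a \<in> set xs") auto
    with u show ?r by (intro exI[of _ u]) auto
  next
    assume ?r
    then obtain u where u: "\<forall>x\<in>set (a # xs). u x \<in> fst M"
      "\<forall>x. x \<notin> set (a # xs) \<longrightarrow> u x = v x" "sat M \<phi> u" by blast
    then have "sat M (exs xs \<phi>) (v(a := u a))" unfolding Cons by (intro exI[of _ u]) auto
    with u(1) show ?l by (auto simp: exs_def)
  qed
qed

lemma sat_alls:
  "sat M (alls xs \<phi>) v \<longleftrightarrow>
     (\<forall>u. (\<forall>x\<in>set xs. u x \<in> fst M) \<longrightarrow> (\<forall>x. x \<notin> set xs \<longrightarrow> u x = v x) \<longrightarrow> sat M \<phi> u)"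
proof -
  have "sat M (alls xs \<phi>) v \<longleftrightarrow> \<not> sat M (exs xs (Neg \<phi>)) v" for v
    by (induction xs arbitrary: v) (simp_all add: alls_def exs_def)
  then show ?thesis unfolding sat_exs by auto
qed

lemma fv_exs: "fv (exs xs \<phi>) = fv \<phi> - set xs"
  by (induction xs) (auto simp: exs_def)

lemma fv_alls: "fv (alls xs \<phi>) = fv \<phi> - set xs"
  by (induction xs) (auto simp: alls_def)


section \<open>Transfer of $\Sigma_3$ sentences\<close>

definition embedding :: "('a \<Rightarrow> 'b) \<Rightarrow> 'a struc \<Rightarrow> 'b struc \<Rightarrow> bool" where
  "embedding e M N \<longleftrightarrow> e ` fst M \<subseteq> fst N \<and> inj_on e (fst M) \<and>
     (\<forall>x\<in>fst M. \<forall>y\<in>fst M. (x, y) \<in> snd M \<longleftrightarrow> (e x, e y) \<in> snd N)"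

text \<open>\<open>P\<close> holds the parameters already in play, \<open>F\<close> the values of a
  universal block over \<open>N\<close>. The embedding may depend on both, but on \<open>P\<close>
  it has to agree with the one map \<open>i\<close>.\<close>

definition finitely_covers :: "('a \<Rightarrow> 'b) \<Rightarrow> 'a struc \<Rightarrow> 'b struc \<Rightarrow> bool" where
  "finitely_covers i M N \<longleftrightarrow> (\<forall>P F. finite P \<and> P \<subseteq> fst M \<and> finite F \<and> F \<subseteq> fst N \<longrightarrow>
     (\<exists>e. embedding e M N \<and> (\<forall>x\<in>P. e x = i x) \<and> F \<subseteq> e ` fst M))"

lemma embedding_qfree:
  assumes "embedding e M N" "qfree \<phi>" "\<forall>x\<in>fv \<phi>. v x \<in> fst M \<and> w x = e (v x)"
  shows "sat M \<phi> v \<longleftrightarrow> sat N \<phi> w"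
  using assms(2,3) by induction (use assms(1) in \<open>auto simp: embedding_def inj_on_def\<close>)

text \<open>Existential witnesses are carried along \<open>e\<close>. The level is only bounded
  because levels are not cumulative: a quantifier-free formula has level 0 but not level 1.\<close>

lemma embedding_Sigma1:
  assumes e: "embedding e M N" and "Sigma_fm \<beta> \<phi>" "\<beta> \<le> (1::nat)"
    and v: "\<forall>x\<in>fv \<phi>. v x \<in> fst M \<and> w x = e (v x)" and sat: "sat M \<phi> v"
  shows "sat N \<phi> w"
  using assms(2)
proof cases
  case 1
  then show ?thesis using embedding_qfree[OF e _ v] sat by blast
next
  case (2 G xs)
  from sat obtain n where "sat M (exs (xs n) (G n)) v" by (auto simp: 2)
  then obtain u where u: "\<forall>x\<in>set (xs n). u x \<in> fst M"
    "\<forall>x. x \<notin> set (xs n) \<longrightarrow> u x = v x" "sat M (G n) u" unfolding sat_exs by blast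
  define u' where "u' x = (if x \<in> set (xs n) then e (u x) else w x)" for x
  obtain \<gamma> where "Pi_fm \<gamma> (G n)" "\<gamma> < \<beta>" using 2 by blast
  then have "qfree (G n)" using assms(3) by (auto elim: Pi_fm.cases simp: bot_nat_def)
  moreover have "\<forall>x\<in>fv (G n). u x \<in> fst M \<and> u' x = e (u x)"
    using v u(1,2) by (force simp: 2 fv_exs u'_def)
  ultimately have "sat N (G n) u'" using embedding_qfree[OF e] u(3) by blast
  moreover have "\<forall>x\<in>set (xs n). u' x \<in> fst N" using e u(1) by (auto simp: u'_def embedding_def)
  ultimately have "sat N (exs (xs n) (G n)) w" unfolding sat_exs by (intro exI[of _ u']) (auto simp: u'_def)
  then show ?thesis by (auto simp: 2)
qed

text \<open>For given values of the universal block in \<open>N\<close>, an embedding is chosen that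
  hits them and agrees with \<open>i\<close> on the parameters. The values are pulled back to
  \<open>M\<close>, and the Sigma_1 instance true there is pushed forward. Finiteness of
  \<open>fv \<phi>\<close> makes the parameters an admissible \<open>P\<close>.\<close>

lemma finitely_covers_Pi2:
  assumes cov: "finitely_covers i M N" and "Pi_fm \<beta> \<phi>" "\<beta> \<le> (2::nat)" "finite (fv \<phi>)"
    and v: "\<forall>x\<in>fv \<phi>. v x \<in> fst M \<and> w x = i (v x)" and sat: "sat M \<phi> v"
  shows "sat N \<phi> w"
proof -
  have P: "finite (v ` fv \<phi>)" "v ` fv \<phi> \<subseteq> fst M" using assms(4) v by auto
  show ?thesis
    using assms(2)
  proof cases
    case 1
    obtain e where "embedding e M N" "\<forall>x\<in>v ` fv \<phi>. e x = i x"
      using cov P unfolding finitely_covers_def by (metis empty_subsetI finite.emptyI)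
    then show ?thesis using embedding_qfree[of e M N \<phi> v w] 1 sat v by simp
  next
    case (2 G xs)
    have "sat N (G n) u" if u: "\<forall>x\<in>set (xs n). u x \<in> fst N" "\<forall>x. x \<notin> set (xs n) \<longrightarrow> u x = w x" for n u
    proof -
      obtain e where e: "embedding e M N" "\<forall>x\<in>v ` fv \<phi>. e x = i x" "u ` set (xs n) \<subseteq> e ` fst M"
        using cov P u(1) unfolding finitely_covers_def by (metis finite_imageI finite_set image_subsetI)
      define u' where "u' x = (if x \<in> set (xs n) then inv_into (fst M) e (u x) else v x)" for x
      have u': "u' x \<in> fst M" "e (u' x) = u x" if "x \<in> set (xs n)" for x
        using that e(3) by (auto simp: u'_def inv_into_into f_inv_into_f image_subset_iff)
      have "sat M (alls (xs n) (G n)) v" using sat by (simp add: 2)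
      then have "sat M (G n) u'" unfolding sat_alls using u'(1) by (auto simp: u'_def)
      moreover have "\<forall>x\<in>fv (G n). u' x \<in> fst M \<and> u x = e (u' x)"
      proof
        fix x assume x: "x \<in> fv (G n)"
        show "u' x \<in> fst M \<and> u x = e (u' x)"
        proof (cases "x \<in> set (xs n)")
          case False
          then have "x \<in> fv \<phi>" using x by (auto simp: 2 fv_alls)
          then show ?thesis using False v u(2) e(2) by (simp add: u'_def)
        qed (use u' in simp)
      qed
      moreover obtain \<gamma> where "Sigma_fm \<gamma> (G n)" "\<gamma> < \<beta>" using 2 by blast
      ultimately show ?thesis using embedding_Sigma1[OF e(1), of \<gamma>] assms(3) by simp
    qed
    then show ?thesis by (simp add: 2 sat_alls)
  qed
qed

text \<open>The witnesses move along \<open>i\<close> itself. In a sentence the free variables of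
  the Pi_2 part lie in the finite block, so \<open>finitely_covers_Pi2\<close> applies.\<close>

lemma finitely_covers_Sigma3:
  assumes cov: "finitely_covers i M N" and "Sigma_fm \<beta> \<phi>" "\<beta> \<le> (3::nat)" "fv \<phi> = {}"
    and sat: "sat M \<phi> v"
  shows "sat N \<phi> w"
  using assms(2)
proof cases
  case 1
  obtain e where "embedding e M N"
    using cov unfolding finitely_covers_def by (metis empty_subsetI finite.emptyI)
  then show ?thesis using embedding_qfree[of e M N \<phi> v w] 1 sat assms(4) by simp
next
  case (2 G xs)
  from sat obtain n where "sat M (exs (xs n) (G n)) v" by (auto simp: 2)
  then obtain u where u: "\<forall>x\<in>set (xs n). u x \<in> fst M" "sat M (G n) u" unfolding sat_exs by blast
  define u' where "u' x = (if x \<in> set (xs n) then i (u x) else w x)" for x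
  have fvG: "fv (G n) \<subseteq> set (xs n)" using assms(4) by (auto simp: 2 fv_exs)
  \<comment> \<open>\<open>i\<close> is not assumed to map into \<open>N\<close>; on the witnesses
    it does, because it agrees there with an embedding.\<close>
  have "\<exists>e. embedding e M N \<and> (\<forall>x\<in>u ` set (xs n). e x = i x)"
    using cov u(1) unfolding finitely_covers_def
    by (metis empty_subsetI finite.emptyI finite_imageI finite_set image_subsetI)
  then have "i (u x) \<in> fst N" if "x \<in> set (xs n)" for x
    using that u(1) unfolding embedding_def by (metis image_eqI image_subset_iff)
  then have u'N: "\<forall>x\<in>set (xs n). u' x \<in> fst N" by (simp add: u'_def)
  obtain \<gamma> where "Pi_fm \<gamma> (G n)" "\<gamma> < \<beta>" using 2 by blast
  then have "sat N (G n) u'"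
    using finitely_covers_Pi2[OF cov, of \<gamma> "G n" u u'] assms(3) fvG u finite_subset[OF fvG]
    by (auto simp: u'_def subset_iff)
  then have "sat N (exs (xs n) (G n)) w" unfolding sat_exs using u'N
    by (intro exI[of _ u']) (auto simp: u'_def)
  then show ?thesis by (auto simp: 2)
qed

lemma embedding_converse: "embedding e (D, r\<inverse>) (E, s\<inverse>) \<longleftrightarrow> embedding e (D, r) (E, s)"
  unfolding embedding_def by auto

lemma finitely_covers_converse:
  "finitely_covers i (D, r\<inverse>) (E, s\<inverse>) \<longleftrightarrow> finitely_covers i (D, r) (E, s)"
  unfolding finitely_covers_def embedding_converse by simp


text \<open>A copy of $\omega$ is inserted after the elements with finitely many predecessors.\<close>

lemma ex_finitely_covers:
  fixes D :: "'a set"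
  assumes D: "lin D r" and inf: "infinite {x\<in>D. finite (below D r x)}" and cD: "countable D"
  shows "\<exists>i (E :: ('a + nat) set) s. countable E \<and> finitely_covers i (D, r) (E, s) \<and>
           lin E s \<and> \<not> two_ended E s"
proof -
  define A where "A = {x\<in>D. finite (below D r x)}"
  define p where "p x = card (below D r x)" for x
  define E :: "('a + nat) set" where "E = Inl ` D \<union> range Inr"
  define s :: "('a + nat) rel" where "s = {(x, y). case (x, y) of (Inl x, Inl y) \<Rightarrow> (x, y) \<in> r | (Inl x, Inr _) \<Rightarrow> x \<in> A
    | (Inr _, Inl y) \<Rightarrow> y \<notin> A | (Inr m, Inr n) \<Rightarrow> m \<le> n}"
  have E_simps: "Inl x \<in> E \<longleftrightarrow> x \<in> D" "Inr m \<in> E" for x m by (auto simp: E_def)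
  have s_simps: "(Inl x, Inl y) \<in> s \<longleftrightarrow> (x, y) \<in> r" "(Inl x, Inr n) \<in> s \<longleftrightarrow> x \<in> A"
    "(Inr m, Inl y) \<in> s \<longleftrightarrow> y \<notin> A" "(Inr m, Inr n) \<in> s \<longleftrightarrow> m \<le> n" for x y m n
    by (simp_all add: s_def)
  have posA: "pos_at D r (p x) x" if "x \<in> A" for x using that by (simp add: A_def p_def pos_at_def)
  have Adown: "x \<in> A" if "y \<in> A" "x \<in> D" "(x, y) \<in> r" for x y
    using that below_psubset[OF D, of x y] unfolding A_def
    by (cases "x = y") (auto intro: finite_subset)
  have inj: "inj_on p A" by (rule inj_onI) (metis posA pos_at_unique[OF D])
  \<comment> \<open>\<open>A\<close> has type omega: its positions are infinitely many, hence
    unbounded, and closed downwards.\<close>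
  have onto: "\<exists>x\<in>A. p x = j" for j
  proof -
    have "infinite (p ` A)" using inf inj finite_imageD unfolding A_def by blast
    then obtain x where "x \<in> A" "j \<le> p x" by (metis finite_nat_set_iff_bounded imageE not_le)
    then obtain y where "pos_at D r j y" using pos_at_down[OF D] posA by blast
    then show ?thesis by (auto simp: pos_at_def A_def p_def)
  qed
  have p_le: "(x, y) \<in> r \<longleftrightarrow> p x \<le> p y" if "x \<in> A" "y \<in> A" for x y
    using pos_at_le_iff[OF D posA posA] that by blast
  have AD: "x \<in> D" if "x \<in> A" for x using that by (simp add: A_def)
  have cross: "(x, y) \<in> r" "(y, x) \<notin> r" if "x \<in> A" "y \<in> D" "y \<notin> A" for x y
    using that Adown lin_total[OF D] AD by blast+
  have "lin E s" unfolding lin_def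
  proof (intro conjI ballI impI)
    fix x y z assume "x \<in> E" "y \<in> E" "z \<in> E" "(x, y) \<in> s" "(y, z) \<in> s"
    then show "(x, z) \<in> s"
      apply (cases x; cases y; cases z; simp add: E_simps s_simps)
      subgoal by (rule lin_trans[OF D])
      subgoal by (rule Adown)
      subgoal by (rule cross(1))
      subgoal using Adown by blast
      done
  next
    fix x y assume "x \<in> E" "y \<in> E" "(x, y) \<in> s" "(y, x) \<in> s"
    then show "x = y"
      using lin_antisym[OF D] by (cases x; cases y; simp add: E_simps s_simps)
  next
    fix x y assume "x \<in> E" "y \<in> E"
    then show "(x, y) \<in> s \<or> (y, x) \<in> s"
      using lin_total[OF D] by (cases x; cases y; simp add: E_simps s_simps) linarith
  next
    fix x assume "x \<in> E"
    then show "(x, x) \<in> s" using lin_refl[OF D] by (cases x; simp add: E_simps s_simps)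
  qed
  moreover have "\<not> two_ended E s"
  proof -
    have "Inl ` A \<subseteq> below E s (Inr 0)" using AD by (auto simp: below_def E_simps s_simps)
    moreover have "Inr ` {0<..} \<subseteq> below E (s\<inverse>) (Inr 0)" by (auto simp: below_def E_simps s_simps)
    moreover have "infinite (Inl ` A :: ('a + nat) set)" "infinite (Inr ` {0::nat<..} :: ('a + nat) set)"
      using inf infinite_Ioi by (simp_all add: A_def finite_image_iff)
    ultimately have "infinite (below E s (Inr 0))" "infinite (below E (s\<inverse>) (Inr 0))"
      using finite_subset by blast+
    moreover have "Inr 0 \<in> E" by (simp add: E_simps)
    ultimately show ?thesis unfolding two_ended_def by blast
  qed
  moreover have "finitely_covers Inl (D, r) (E, s)"
    unfolding finitely_covers_def
  proof (intro allI impI; elim conjE)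
    fix P :: "'a set" and F assume P: "finite P" "P \<subseteq> fst (D, r)" and F: "finite F" "F \<subseteq> fst (E, s)"
    have "finite (p ` (P \<union> Inl -` F))" using P(1) F(1) by (simp add: finite_vimageI)
    \<comment> \<open>\<open>n\<close> exceeds the positions of all points that must stay put;
      outside \<open>A\<close> the value of \<open>p\<close> is 0, which does no harm.\<close>
    then obtain n where n: "\<And>x. x \<in> P \<or> Inl x \<in> F \<Longrightarrow> p x < n"
      unfolding finite_nat_set_iff_bounded by auto
    \<comment> \<open>The element of \<open>A\<close> at position \<open>n + m\<close> shifts to
      \<open>Inr m\<close> and everything else stays. So \<open>P\<close> and the old points of
      \<open>F\<close> are fixed, and every new point is hit.\<close>
    define e where "e x = (if x \<in> A \<and> n \<le> p x then Inr (p x - n) else Inl x)" for x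
    have "embedding e (D, r) (E, s)"
      unfolding embedding_def
    proof (intro conjI ballI inj_onI)
      fix x y assume "x \<in> fst (D, r)" "y \<in> fst (D, r)" "e x = e y"
      then show "x = y" using inj by (auto simp: e_def inj_on_def split: if_splits)
    next
      fix x y assume "x \<in> fst (D, r)" "y \<in> fst (D, r)"
      then show "(x, y) \<in> snd (D, r) \<longleftrightarrow> (e x, e y) \<in> snd (E, s)"
        using p_le cross by (cases "x \<in> A"; cases "y \<in> A") (auto simp: e_def s_simps)
    qed (auto simp: e_def E_simps)
    moreover have "\<forall>x\<in>P. e x = Inl x" using n by (force simp: e_def)
    moreover have "F \<subseteq> e ` D"
    proof
      fix z assume z: "z \<in> F"
      show "z \<in> e ` D"
      proof (cases z)
        case (Inl x)
        then have "e x = z" "x \<in> D" using n z F(2) by (force simp: e_def E_simps)+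
        then show ?thesis by blast
      next
        case (Inr m)
        obtain x where "x \<in> A" "p x = n + m" using onto by blast
        then have "e x = z" "x \<in> D" using Inr AD by (simp_all add: e_def)
        then show ?thesis by blast
      qed
    qed
    ultimately show "\<exists>e. embedding e (D, r) (E, s) \<and> (\<forall>x\<in>P. e x = Inl x) \<and> F \<subseteq> e ` fst (D, r)"
      by auto
  qed
  moreover have "countable E" using cD by (simp add: E_def)
  ultimately show ?thesis by blast
qed

lemma two_ended_converse: "two_ended D (r\<inverse>) \<longleftrightarrow> two_ended D r"
  unfolding two_ended_def by auto

lemma two_ended_ex_finitely_covers:
  fixes D :: "'a set"
  assumes D: "lin D r" "two_ended D r" "infinite D" "countable D"
  shows "\<exists>i (E :: ('a + nat) set) s. countable E \<and> finitely_covers i (D, r) (E, s) \<and> \<not> two_ended E s"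
proof -
  have "D = {x\<in>D. finite (below D r x)} \<union> {x\<in>D. finite (below D (r\<inverse>) x)}"
    using D(2) unfolding two_ended_def by blast
  then consider "infinite {x\<in>D. finite (below D r x)}" | "infinite {x\<in>D. finite (below D (r\<inverse>) x)}"
    using D(3) by (metis finite_UnI)
  then show ?thesis
  proof cases
    case 1
    from ex_finitely_covers[OF D(1) this D(4)] show ?thesis by blast
  next
    case 2
    from ex_finitely_covers[OF lin_converse[OF D(1)] this D(4)] obtain i and E :: "('a + nat) set" and s
      where "countable E" "finitely_covers i (D, r\<inverse>) (E, s)" "\<not> two_ended E s" by blast
    moreover from this(2) have "finitely_covers i (D, r) (E, s\<inverse>)"
      using finitely_covers_converse[of i D r E "s\<inverse>"] by simp
    ultimately show ?thesis using two_ended_converse by blast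
  qed
qed


section \<open>The Scott sentence\<close>

text \<open>Variable \<open>i + 2\<close> names the \<open>i\<close>-th element of an initial segment (of a final one, for \<open>d\<close> false).\<close>

definition le_fm :: "bool \<Rightarrow> nat \<Rightarrow> nat \<Rightarrow> fm" where
  "le_fm d x y = (if d then Le x y else Le y x)"

primrec among :: "nat \<Rightarrow> nat \<Rightarrow> fm" where
  "among v 0 = Neg Tru"
| "among v (Suc k) = Or (among v k) (Eq v (Suc (Suc k)))"

text \<open>The matrix of \<open>seg\<close>, with variable 0 as the running \<open>z\<close>;
  variable 1 is reserved for the point treated in \<open>near_end\<close>. Membership in the domain
  needs no clause, as quantified variables range over it.\<close>

primrec initial :: "bool \<Rightarrow> nat \<Rightarrow> fm" where
  "initial d 0 = Tru"
| "initial d (Suc k) = And (initial d k)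
     (And (Neg (among (Suc (Suc k)) k)) (Or (among 0 k) (le_fm d (Suc (Suc k)) 0)))"

primrec yvars :: "nat \<Rightarrow> nat list" where
  "yvars 0 = []"
| "yvars (Suc k) = Suc (Suc k) # yvars k"

text \<open>The constant \<open>BigOr\<close> and \<open>BigAnd\<close> serve the grammar of levels,
  where quantifier blocks occur only inside an infinitary connective.\<close>

definition seg_fm :: "bool \<Rightarrow> nat \<Rightarrow> fm" where
  "seg_fm d k = BigOr (\<lambda>_. exs (yvars k) (BigAnd (\<lambda>_. alls [0] (initial d k))))"

text \<open>The negation of \<open>seg_fm\<close>. There is no outer \<open>BigAnd\<close>: a
  universal block over a Sigma_1 formula can itself be a member of a Pi_3 conjunction.\<close>

definition no_seg_fm :: "bool \<Rightarrow> nat \<Rightarrow> fm" where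
  "no_seg_fm d k = alls (yvars k) (BigOr (\<lambda>_. exs [0] (Neg (initial d k))))"

text \<open>\<open>among 1 k\<close> does not mention variable 0, but stands under its quantifier so
  that the body stays Pi_1.\<close>

definition near_end :: "bool \<Rightarrow> nat \<Rightarrow> fm" where
  "near_end d k = exs (yvars k) (BigAnd (\<lambda>_. alls [0] (And (initial d k) (among 1 k))))"

definition two_ended_fm :: fm where
  "two_ended_fm = alls [1] (BigOr (join (near_end True) (near_end False)))"

definition lin_fm :: fm where
  "lin_fm = alls [0, 1, 2] (And (Le 0 0) (And (Or (Neg (And (Le 0 1) (Le 1 2))) (Le 0 2))
     (And (Or (Neg (And (Le 0 1) (Le 1 0))) (Eq 0 1)) (Or (Le 0 1) (Le 1 0)))))"

definition has_seg :: "'a set \<Rightarrow> 'a rel \<Rightarrow> bool \<Rightarrow> nat \<Rightarrow> bool" where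
  "has_seg D r d k \<longleftrightarrow> (\<exists>y. seg D (at_end d r) k y)"

text \<open>
  The number \<open>a\<close> is a constant of the family, which is therefore computable although \<open>a\<close> and the
  case distinction need not be computable from the order.
\<close>

definition end_fms :: "'a set \<Rightarrow> 'a rel \<Rightarrow> bool \<Rightarrow> nat \<Rightarrow> fm" where
  "end_fms D r d = (if \<forall>k. has_seg D r d k then seg_fm d
     else let a = LEAST k. \<not> has_seg D r d (Suc k)
       in join (\<lambda>_. seg_fm d a) (\<lambda>_. no_seg_fm d (Suc a)))"

definition scott_fm :: "'a set \<Rightarrow> 'a rel \<Rightarrow> fm" where
  "scott_fm D r = BigAnd (join (join (\<lambda>_. lin_fm) (\<lambda>_. two_ended_fm))
     (join (end_fms D r True) (end_fms D r False)))"

lemma set_yvars: "set (yvars k) = (\<lambda>i. Suc (Suc i)) ` {..<k}"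
  by (induction k) (auto simp: lessThan_Suc)


subsection \<open>Computability\<close>

lemmas recf_intros = recf_const recf_id recf_pair recf_comp[OF recf_Suc] recf_comp[OF recf_pf] recf_comp[OF recf_ps]

lemma ucomp_rec_And:
  assumes "ucomp X"
  shows "ucomp (\<lambda>n. rec_nat Tru (\<lambda>m \<phi>. And \<phi> (X m)) n)"
proof -
  obtain x where x: "recf x" "\<And>n. codes (x n) (X n)" using assms by (rule ucompE) blast
  show ?thesis
    \<comment> \<open>In the packed argument, \<open>ps (ps n)\<close> is the code built so far and
      \<open>pf (ps n)\<close> the index \<open>m\<close>; 4 is the tag of \<open>And\<close> in
      \<open>codes\<close>.\<close>
    by (rule ucomp_rec[where F = "\<lambda>_. Tru" and a = "\<lambda>_. 0" and b = "\<lambda>n. n" and H = "\<lambda>_ m \<phi>. And \<phi> (X m)"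
        and h = "\<lambda>n. prod_encode (4, prod_encode (ps (ps n), x (pf (ps n))))"])
      (auto intro!: recf_intros recf_comp[OF x(1)] ucomp_Tru codes.intros(5) x(2))
qed

lemma ucomp_exs:
  assumes "ucomp F" "recf b"
  shows "ucomp (\<lambda>n. exs (yvars (b n)) (F n))"
proof -
  have "exs (yvars k) \<phi> = rec_nat \<phi> (\<lambda>m. Ex (Suc (Suc m))) k" for k \<phi>
    by (induction k) (simp_all add: exs_def)
  moreover have "ucomp (\<lambda>n. rec_nat (F n) (\<lambda>m. Ex (Suc (Suc m))) (b n))"
    by (rule ucomp_rec[where F = F and a = "\<lambda>n. n" and H = "\<lambda>_ m. Ex (Suc (Suc m))"
        and h = "\<lambda>n. prod_encode (6, prod_encode (Suc (Suc (pf (ps n))), ps (ps n)))"])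
      (auto intro!: recf_intros assms codes.intros(7))
  ultimately show ?thesis by simp
qed

lemma ucomp_alls:
  assumes "ucomp F" "recf b"
  shows "ucomp (\<lambda>n. alls (yvars (b n)) (F n))"
proof -
  have "alls (yvars k) \<phi> = rec_nat \<phi> (\<lambda>m. All (Suc (Suc m))) k" for k \<phi>
    by (induction k) (simp_all add: alls_def)
  moreover have "ucomp (\<lambda>n. rec_nat (F n) (\<lambda>m. All (Suc (Suc m))) (b n))"
    by (rule ucomp_rec[where F = F and a = "\<lambda>n. n" and H = "\<lambda>_ m. All (Suc (Suc m))"
        and h = "\<lambda>n. prod_encode (7, prod_encode (Suc (Suc (pf (ps n))), ps (ps n)))"])
      (auto intro!: recf_intros assms codes.intros(8))
  ultimately show ?thesis by simp
qed

lemma ucomp_among: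
  assumes "recf a" "recf b"
  shows "ucomp (\<lambda>n. among (a n) (b n))"
proof -
  have "among v k = rec_nat (Neg Tru) (\<lambda>m \<phi>. Or \<phi> (Eq v (Suc (Suc m)))) k" for v k
    by (induction k) simp_all
  moreover have "ucomp (\<lambda>n. rec_nat (Neg Tru) (\<lambda>m \<phi>. Or \<phi> (Eq (a n) (Suc (Suc m)))) (b n))"
    by (rule ucomp_rec[where F = "\<lambda>_. Neg Tru" and H = "\<lambda>v m \<phi>. Or \<phi> (Eq v (Suc (Suc m)))"
        and h = "\<lambda>n. prod_encode (5, prod_encode (ps (ps n),
                   prod_encode (2, prod_encode (pf n, Suc (Suc (pf (ps n)))))))"])
      (auto intro!: recf_intros assms ucomp_Neg ucomp_Tru codes.intros(3,6))
  ultimately show ?thesis by simp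
qed

lemma ucomp_le_fm: "recf a \<Longrightarrow> recf b \<Longrightarrow> ucomp (\<lambda>n. le_fm d (a n) (b n))"
  by (cases d) (simp_all add: le_fm_def ucomp_Le)

lemma ucomp_initial: "ucomp (initial d)"
proof -
  let ?X = "\<lambda>m. And (Neg (among (Suc (Suc m)) m)) (Or (among 0 m) (le_fm d (Suc (Suc m)) 0))"
  have "ucomp ?X"
    by (intro ucomp_And ucomp_Neg ucomp_Or ucomp_among ucomp_le_fm recf_intros)
  then have "ucomp (\<lambda>n. rec_nat Tru (\<lambda>m \<phi>. And \<phi> (?X m)) n)" by (rule ucomp_rec_And)
  moreover have "initial d = (\<lambda>n. rec_nat Tru (\<lambda>m \<phi>. And \<phi> (?X m)) n)"
  proof
    show "initial d n = rec_nat Tru (\<lambda>m \<phi>. And \<phi> (?X m)) n" for n by (induction n) simp_all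
  qed
  ultimately show ?thesis by simp
qed

lemma ucomp_BigOr_const: "ucomp F \<Longrightarrow> ucomp (\<lambda>n. BigOr (\<lambda>_. F n))"
  and ucomp_BigAnd_const: "ucomp F \<Longrightarrow> ucomp (\<lambda>n. BigAnd (\<lambda>_. F n))"
  by (intro ucomp_Big ucomp_comp[OF _ recf_pf]; assumption)+

lemma exs_single: "exs [x] \<phi> = Ex x \<phi>" and alls_single: "alls [x] \<phi> = All x \<phi>"
  by (simp_all add: exs_def alls_def)

lemma ucomp_seg_fm: "ucomp (seg_fm d)"
  unfolding seg_fm_def[abs_def] alls_single
  by (intro ucomp_BigOr_const ucomp_BigAnd_const ucomp_exs ucomp_All ucomp_initial recf_intros)

lemma ucomp_no_seg_fm: "ucomp (no_seg_fm d)"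
  unfolding no_seg_fm_def[abs_def] exs_single
  by (intro ucomp_BigOr_const ucomp_alls ucomp_Ex ucomp_Neg ucomp_initial recf_intros)

lemma ucomp_near_end: "ucomp (near_end d)"
  unfolding near_end_def[abs_def] alls_single
  by (intro ucomp_BigAnd_const ucomp_exs ucomp_All ucomp_And ucomp_initial ucomp_among recf_intros)

lemma ucomp_two_ended_fm: "ucomp (\<lambda>_. two_ended_fm)"
  unfolding two_ended_fm_def alls_single
  by (intro ucomp_All ucomp_BigOr ucomp_comp[OF ucomp_join recf_ps] ucomp_near_end recf_intros)

lemma ucomp_lin_fm: "ucomp (\<lambda>_. lin_fm)"
  unfolding lin_fm_def alls_def foldr.simps o_apply id_apply
  by (intro ucomp_All ucomp_And ucomp_Or ucomp_Neg ucomp_Le ucomp_Eq recf_intros)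

lemma ucomp_end_fms: "ucomp (end_fms D r d)"
  unfolding end_fms_def Let_def
  by (simp add: ucomp_seg_fm ucomp_join ucomp_comp[OF ucomp_seg_fm recf_const]
      ucomp_comp[OF ucomp_no_seg_fm recf_const])

lemma computable_scott_fm: "computable_fm (scott_fm D r)"
proof -
  have "ucomp (\<lambda>_. scott_fm D r)"
    unfolding scott_fm_def
    by (intro ucomp_BigAnd ucomp_comp[OF ucomp_join recf_ps] ucomp_join ucomp_lin_fm
        ucomp_two_ended_fm ucomp_end_fms)
  then show ?thesis by (rule computable_fm_ucomp)
qed


subsection \<open>Complexity\<close>

text \<open>The introduction rule wants blocks and kernels as functions of \<open>n\<close>; choice
  provides them. A condition on the range suits families built by \<open>join\<close>.\<close>

lemma Sigma_fm_BigOr: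
  assumes "bot < \<alpha>" "\<And>\<phi>. \<phi> \<in> range F \<Longrightarrow> \<exists>xs G \<beta>. \<phi> = exs xs G \<and> \<beta> < \<alpha> \<and> Pi_fm \<beta> G"
  shows "Sigma_fm \<alpha> (BigOr F)"
proof -
  have "\<forall>n. \<exists>xs G. F n = exs xs G \<and> (\<exists>\<beta><\<alpha>. Pi_fm \<beta> G)" using assms(2) by blast
  then obtain xs G where "\<And>n. F n = exs (xs n) (G n)" "\<And>n. \<exists>\<beta><\<alpha>. Pi_fm \<beta> (G n)" by metis
  moreover from this(1) have "F = (\<lambda>n. exs (xs n) (G n))" by blast
  ultimately show ?thesis using Sigma_fm_Pi_fm.intros(3)[OF assms(1)] by simp
qed

lemma Pi_fm_BigAnd:
  assumes "bot < \<alpha>" "\<And>\<phi>. \<phi> \<in> range F \<Longrightarrow> \<exists>xs G \<beta>. \<phi> = alls xs G \<and> \<beta> < \<alpha> \<and> Sigma_fm \<beta> G"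
  shows "Pi_fm \<alpha> (BigAnd F)"
proof -
  have "\<forall>n. \<exists>xs G. F n = alls xs G \<and> (\<exists>\<beta><\<alpha>. Sigma_fm \<beta> G)" using assms(2) by blast
  then obtain xs G where "\<And>n. F n = alls (xs n) (G n)" "\<And>n. \<exists>\<beta><\<alpha>. Sigma_fm \<beta> (G n)" by metis
  moreover from this(1) have "F = (\<lambda>n. alls (xs n) (G n))" by blast
  ultimately show ?thesis using Sigma_fm_Pi_fm.intros(4)[OF assms(1)] by simp
qed

lemma qfree_among: "qfree (among v k)"
  by (induction k) (auto intro: qfree.intros)

lemma qfree_initial: "qfree (initial d k)"
  by (induction k) (simp_all add: le_fm_def qfree.intros qfree_among)

lemma qfree_Sigma_0: "qfree \<phi> \<Longrightarrow> Sigma_fm (0::nat) \<phi>"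
  and qfree_Pi_0: "qfree \<phi> \<Longrightarrow> Pi_fm (0::nat) \<phi>"
  unfolding bot_nat_def[symmetric] by (rule Sigma_fm_Pi_fm.intros; assumption)+

lemma Pi_1_all: "qfree \<phi> \<Longrightarrow> Pi_fm (1::nat) (BigAnd (\<lambda>_. alls xs \<phi>))"
  by (rule Pi_fm_BigAnd) (auto simp: bot_nat_def dest: qfree_Sigma_0)

lemma Sigma_1_ex: "qfree \<phi> \<Longrightarrow> Sigma_fm (1::nat) (BigOr (\<lambda>_. exs xs \<phi>))"
  by (rule Sigma_fm_BigOr) (auto simp: bot_nat_def dest: qfree_Pi_0)

text \<open>The shape of a member of a Pi_3 conjunction; through the empty block it admits every
  Sigma formula below level 3.\<close>

definition clause :: "fm \<Rightarrow> bool" where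
  "clause \<phi> \<longleftrightarrow> (\<exists>xs G \<beta>. \<phi> = alls xs G \<and> \<beta> < (3::nat) \<and> Sigma_fm \<beta> G)"

lemma clauseI: "Sigma_fm (\<beta>::nat) G \<Longrightarrow> \<beta> < 3 \<Longrightarrow> clause (alls xs G)"
  unfolding clause_def by blast

lemma Sigma_2_segment:
  assumes "qfree \<phi>"
  shows "\<exists>xs G \<beta>. exs (yvars k) (BigAnd (\<lambda>_. alls [0] \<phi>)) = exs xs G \<and> \<beta> < (2::nat) \<and> Pi_fm \<beta> G"
  using Pi_1_all[OF assms] one_less_numeral_iff semiring_norm(76) by blast

lemma clause_seg_fm: "clause (seg_fm d k)"
proof -
  have "Sigma_fm (2::nat) (seg_fm d k)" unfolding seg_fm_def
    by (rule Sigma_fm_BigOr) (use Sigma_2_segment[OF qfree_initial] in \<open>auto simp: bot_nat_def\<close>)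
  from clauseI[OF this, of "[]"] show ?thesis by (simp add: alls_def)
qed

lemma clause_no_seg_fm: "clause (no_seg_fm d k)"
  unfolding no_seg_fm_def
  by (rule clauseI[OF Sigma_1_ex]) (simp_all add: qfree.intros qfree_initial)

lemma clause_two_ended_fm: "clause two_ended_fm"
  unfolding two_ended_fm_def
proof (rule clauseI[of 2])
  have "\<exists>xs G \<beta>. near_end d k = exs xs G \<and> \<beta> < (2::nat) \<and> Pi_fm \<beta> G" for d k
    unfolding near_end_def by (intro Sigma_2_segment qfree.intros qfree_initial qfree_among)
  then show "Sigma_fm (2::nat) (BigOr (join (near_end True) (near_end False)))"
    by (intro Sigma_fm_BigOr) (auto simp: range_join bot_nat_def)
qed simp

lemma clause_lin_fm: "clause lin_fm"
  unfolding lin_fm_def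
  by (rule clauseI[OF qfree_Sigma_0]) (simp_all add: qfree.intros)

lemma clause_end_fms: "clause (end_fms D r d n)"
  by (simp add: end_fms_def Let_def join_def clause_seg_fm clause_no_seg_fm)

lemma Pi_scott_fm: "Pi_fm (3::nat) (scott_fm D r)"
  unfolding scott_fm_def
proof (rule Pi_fm_BigAnd, fold clause_def)
  fix \<phi> assume "\<phi> \<in> range (join (join (\<lambda>_. lin_fm) (\<lambda>_. two_ended_fm))
     (join (end_fms D r True) (end_fms D r False)))"
  then show "clause \<phi>"
    unfolding range_join using clause_lin_fm clause_two_ended_fm clause_end_fms by auto
qed (simp add: bot_nat_def)


subsection \<open>Free variables\<close>

lemma fv_among: "fv (among v k) \<subseteq> {v} \<union> set (yvars k)"
  by (induction k) auto

lemma fv_initial: "fv (initial d k) \<subseteq> {0} \<union> set (yvars k)"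
  by (induction k) (use fv_among in \<open>fastforce simp: le_fm_def split: if_splits\<close>)+

lemma fv_seg_fm: "fv (seg_fm d k) = {}" and fv_no_seg_fm: "fv (no_seg_fm d k) = {}"
  and fv_near_end: "fv (near_end d k) \<subseteq> {1}"
  using fv_initial[of d k] fv_among[of 1 k]
  by (auto simp: seg_fm_def no_seg_fm_def near_end_def fv_exs fv_alls)

lemma fv_join: "fv (BigOr (join F G)) = (\<Union>n. fv (F n)) \<union> (\<Union>n. fv (G n))"
  "fv (BigAnd (join F G)) = (\<Union>n. fv (F n)) \<union> (\<Union>n. fv (G n))"
proof -
  have "(\<Union>n. fv (join F G n)) = (\<Union>\<phi>\<in>range (join F G). fv \<phi>)" by blast
  then show "fv (BigOr (join F G)) = (\<Union>n. fv (F n)) \<union> (\<Union>n. fv (G n))"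
    "fv (BigAnd (join F G)) = (\<Union>n. fv (F n)) \<union> (\<Union>n. fv (G n))"
    unfolding range_join by auto
qed

lemma fv_end_fms: "fv (end_fms D r d n) = {}"
  by (auto simp: end_fms_def Let_def join_def fv_seg_fm fv_no_seg_fm)

lemma fv_scott_fm: "fv (scott_fm D r) = {}"
proof -
  have "fv lin_fm = {}" by (auto simp: lin_fm_def fv_alls)
  moreover have "fv two_ended_fm = {}"
    using fv_near_end unfolding two_ended_fm_def fv_alls fv_join by auto
  ultimately have "fv (join (\<lambda>_. lin_fm) (\<lambda>_. two_ended_fm) n) = {}"
    "fv (join (end_fms D r True) (end_fms D r False) n) = {}" for n
    by (simp_all add: join_def fv_end_fms)
  then show ?thesis unfolding scott_fm_def fv_join by simp
qed


subsection \<open>Semantics\<close>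

lemma sat_among: "sat M (among v k) w \<longleftrightarrow> (\<exists>i<k. w v = w (Suc (Suc i)))"
  by (induction k) (auto simp: less_Suc_eq)

lemma sat_initial:
  "sat (E, s) (initial d k) w \<longleftrightarrow> (\<forall>i<k. w (Suc (Suc i)) \<notin> (\<lambda>j. w (Suc (Suc j))) ` {..<i} \<and>
     (w 0 \<in> (\<lambda>j. w (Suc (Suc j))) ` {..<i} \<or> (w (Suc (Suc i)), w 0) \<in> at_end d s))"
  by (induction k) (auto simp: less_Suc_eq sat_among le_fm_def at_end_def)

lemma sat_all_initial:
  assumes "\<forall>x\<in>set (yvars k). w x \<in> E"
  shows "sat (E, s) (alls [0] (initial d k)) w \<longleftrightarrow> seg E (at_end d s) k (\<lambda>i. w (Suc (Suc i)))"
proof -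
  have yE: "w (Suc (Suc i)) \<in> E" if "i < k" for i using assms that by (auto simp: set_yvars)
  have "sat (E, s) (alls [0] (initial d k)) w \<longleftrightarrow>
    (\<forall>z\<in>E. \<forall>i<k. w (Suc (Suc i)) \<notin> (\<lambda>j. w (Suc (Suc j))) ` {..<i} \<and>
     (z \<in> (\<lambda>j. w (Suc (Suc j))) ` {..<i} \<or> (w (Suc (Suc i)), z) \<in> at_end d s))"
    by (simp add: alls_single sat_initial)
  \<comment> \<open>\<open>yE\<close> also yields an element of \<open>E\<close> when
    \<open>k\<close> is positive, so the distinctness part, which does not mention \<open>z\<close>,
    is not lost under the quantifier.\<close>
  also have "\<dots> \<longleftrightarrow> seg E (at_end d s) k (\<lambda>i. w (Suc (Suc i)))"
    unfolding seg_def using yE by blast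
  finally show ?thesis .
qed

text \<open>\<open>x - 2\<close> undoes the shift by which variable \<open>i + 2\<close> names
  \<open>y i\<close>.\<close>

lemma sat_exs_yvars:
  "sat (E, s) (exs (yvars k) \<phi>) v \<longleftrightarrow>
     (\<exists>y. (\<forall>i<k. y i \<in> E) \<and> sat (E, s) \<phi> (\<lambda>x. if x \<in> set (yvars k) then y (x - 2) else v x))"
  (is "?l \<longleftrightarrow> ?r")
proof
  assume ?l
  then obtain u where u: "\<forall>x\<in>set (yvars k). u x \<in> E" "\<forall>x. x \<notin> set (yvars k) \<longrightarrow> u x = v x"
    "sat (E, s) \<phi> u" unfolding sat_exs by auto
  have "(\<lambda>x. if x \<in> set (yvars k) then u (Suc (Suc (x - 2))) else v x) = u"
    using u(2) by (intro ext) (auto simp: set_yvars)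
  with u(3) have "sat (E, s) \<phi> (\<lambda>x. if x \<in> set (yvars k) then u (Suc (Suc (x - 2))) else v x)"
    by (simp only:)
  moreover have "\<forall>i<k. u (Suc (Suc i)) \<in> E" using u(1) by (simp add: set_yvars)
  ultimately show ?r by (intro exI[of _ "\<lambda>i. u (Suc (Suc i))"]) simp
next
  assume ?r
  then obtain y where y: "\<forall>i<k. y i \<in> E"
    "sat (E, s) \<phi> (\<lambda>x. if x \<in> set (yvars k) then y (x - 2) else v x)" by blast
  then show ?l unfolding sat_exs
    by (intro exI[of _ "\<lambda>x. if x \<in> set (yvars k) then y (x - 2) else v x"]) (auto simp: set_yvars)
qed

lemma seg_cong: "(\<And>i. i < k \<Longrightarrow> y i = y' i) \<Longrightarrow> seg D r k y \<longleftrightarrow> seg D r k y'"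
proof -
  assume *: "\<And>i. i < k \<Longrightarrow> y i = y' i"
  then have "y ` {..<i} = y' ` {..<i}" if "i < k" for i using that by (intro image_cong) auto
  with * show ?thesis by (simp add: seg_def)
qed

lemma sat_initial_yvars:
  assumes "\<forall>i<k. y i \<in> E"
  shows "sat (E, s) (alls [0] (initial d k)) (\<lambda>x. if x \<in> set (yvars k) then y (x - 2) else v x)
     \<longleftrightarrow> seg E (at_end d s) k y"
proof -
  have "\<forall>x\<in>set (yvars k). (if x \<in> set (yvars k) then y (x - 2) else v x) \<in> E"
    using assms by (auto simp: set_yvars)
  from sat_all_initial[OF this] show ?thesis by (subst seg_cong[of k y]) (auto simp: set_yvars)
qed

lemma seg_in: "seg D r k y \<Longrightarrow> \<forall>i<k. y i \<in> D"
  by (simp add: seg_def)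

lemma sat_seg_fm: "sat (E, s) (seg_fm d k) v \<longleftrightarrow> has_seg E s d k"
  unfolding seg_fm_def has_seg_def sat.simps sat_exs_yvars simp_thms
  using sat_initial_yvars seg_in by blast

lemma sat_no_seg_fm: "sat (E, s) (no_seg_fm d k) v \<longleftrightarrow> \<not> has_seg E s d k"
proof -
  have "sat (E, s) (no_seg_fm d k) v \<longleftrightarrow> \<not> sat (E, s) (seg_fm d k) v"
    by (simp add: no_seg_fm_def seg_fm_def sat_exs sat_alls exs_single alls_single) blast
  then show ?thesis by (simp add: sat_seg_fm)
qed

lemma sat_near_end:
  assumes "v 1 \<in> E"
  shows "sat (E, s) (near_end d k) v \<longleftrightarrow> (\<exists>y. seg E (at_end d s) k y \<and> (\<exists>i<k. v 1 = y i))"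
proof -
  \<comment> \<open>\<open>E\<close> contains \<open>v 1\<close>, so the quantifier is not vacuous
    and \<open>among 1 k\<close> can be moved out of it.\<close>
  have split: "sat (E, s) (alls [0] (And \<phi> (among 1 k))) w \<longleftrightarrow>
      sat (E, s) (alls [0] \<phi>) w \<and> (\<exists>i<k. w 1 = w (Suc (Suc i)))" for \<phi> w
    using assms by (auto simp: alls_single sat_among)
  have at_tuple: "sat (E, s) (alls [0] (And (initial d k) (among 1 k)))
      (\<lambda>x. if x \<in> set (yvars k) then y (x - 2) else v x) \<longleftrightarrow>
      seg E (at_end d s) k y \<and> (\<exists>i<k. v 1 = y i)" if "\<forall>i<k. y i \<in> E" for y
  proof -
    have "1 \<notin> set (yvars k)" "\<And>i. i < k \<Longrightarrow> Suc (Suc i) \<in> set (yvars k)" by (auto simp: set_yvars)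
    then show ?thesis unfolding split sat_initial_yvars[OF that] by (simp cong: conj_cong)
  qed
  have "(\<forall>i<k. y i \<in> E) \<and> sat (E, s) (alls [0] (And (initial d k) (among 1 k)))
      (\<lambda>x. if x \<in> set (yvars k) then y (x - 2) else v x) \<longleftrightarrow>
      seg E (at_end d s) k y \<and> (\<exists>i<k. v 1 = y i)" for y
    using at_tuple[of y] seg_in[of E "at_end d s" k y] by argo
  then show ?thesis
    unfolding near_end_def sat_exs_yvars sat.simps simp_thms by (rule iff_exI)
qed

lemma sat_two_ended_fm:
  assumes "lin E s"
  shows "sat (E, s) two_ended_fm v \<longleftrightarrow> two_ended E s"
proof -
  have "sat (E, s) (BigOr (join (near_end True) (near_end False))) w \<longleftrightarrow>
     finite (below E s (w 1)) \<or> finite (below E (s\<inverse>) (w 1))" if w: "w 1 \<in> E" for w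
  proof -
    have "sat (E, s) (BigOr (join (near_end True) (near_end False))) w \<longleftrightarrow>
      (\<exists>\<phi>\<in>range (join (near_end True) (near_end False)). sat (E, s) \<phi> w)" by auto
    also have "\<dots> \<longleftrightarrow> (\<exists>k. sat (E, s) (near_end True k) w) \<or> (\<exists>k. sat (E, s) (near_end False k) w)"
      unfolding range_join by blast
    also have "\<dots> \<longleftrightarrow> finite (below E s (w 1)) \<or> finite (below E (s\<inverse>) (w 1))"
      unfolding sat_near_end[where v = w, OF w] at_end_def if_True if_False
        finite_below_iff[OF assms w] finite_below_iff[OF lin_converse[OF assms] w] by simp
    finally show ?thesis .
  qed
  then show ?thesis
    unfolding two_ended_fm_def alls_single sat.simps(8) two_ended_def by simp
qed

lemma sat_lin_fm: "sat (E, s) lin_fm v \<longleftrightarrow> lin E s"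
proof -
  have *: "sat (E, s) lin_fm v \<longleftrightarrow> (\<forall>x\<in>E. \<forall>y\<in>E. \<forall>z\<in>E. (x, x) \<in> s \<and>
      (\<not> ((x, y) \<in> s \<and> (y, z) \<in> s) \<or> (x, z) \<in> s) \<and>
      (\<not> ((x, y) \<in> s \<and> (y, x) \<in> s) \<or> x = y) \<and> ((x, y) \<in> s \<or> (y, x) \<in> s))"
    by (simp add: lin_fm_def alls_def)
  show ?thesis
  proof
    assume l: "sat (E, s) lin_fm v"
    \<comment> \<open>All axioms share one block of three quantifiers; those with fewer variables
      are read off by repeating an element.\<close>
    have a: "(x, x) \<in> s \<and> (\<not> ((x, y) \<in> s \<and> (y, z) \<in> s) \<or> (x, z) \<in> s) \<and>
      (\<not> ((x, y) \<in> s \<and> (y, x) \<in> s) \<or> x = y) \<and> ((x, y) \<in> s \<or> (y, x) \<in> s)"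
      if "x \<in> E" "y \<in> E" "z \<in> E" for x y z
      by (rule l[unfolded *, THEN bspec, THEN bspec, THEN bspec]) (fact that)+
    show "lin E s" unfolding lin_def
    proof (intro conjI ballI impI)
      fix x y z assume "x \<in> E" "y \<in> E" "z \<in> E" "(x, y) \<in> s" "(y, z) \<in> s"
      then show "(x, z) \<in> s" using a[of x y z] by simp
    next
      fix x y assume "x \<in> E" "y \<in> E" "(x, y) \<in> s" "(y, x) \<in> s"
      then show "x = y" using a[of x y y] by simp
    next
      fix x y assume "x \<in> E" "y \<in> E"
      then show "(x, y) \<in> s \<or> (y, x) \<in> s" using a[of x y y] by simp
    next
      fix x assume "x \<in> E"
      then show "(x, x) \<in> s" using a[of x x x] by simp
    qed
  next
    assume l: "lin E s"
    show "sat (E, s) lin_fm v" unfolding *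
    proof (intro ballI)
      fix x y z assume "x \<in> E" "y \<in> E" "z \<in> E"
      then show "(x, x) \<in> s \<and> (\<not> ((x, y) \<in> s \<and> (y, z) \<in> s) \<or> (x, z) \<in> s) \<and>
        (\<not> ((x, y) \<in> s \<and> (y, x) \<in> s) \<or> x = y) \<and> ((x, y) \<in> s \<or> (y, x) \<in> s)"
        using lin_refl[OF l, of x] lin_trans[OF l, of x y z] lin_antisym[OF l, of x y] lin_total[OF l, of x y]
        by argo
    qed
  qed
qed

lemma has_seg_mono: "has_seg D r d k \<Longrightarrow> j \<le> k \<Longrightarrow> has_seg D r d j"
  unfolding has_seg_def seg_def using less_le_trans by meson

lemma has_seg_0: "has_seg D r d 0"
  by (simp add: has_seg_def seg_def)

text \<open>If some length fails, downward closure leaves a largest length \<open>a\<close>, and the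
  set of lengths is fixed by saying that \<open>a\<close> occurs and \<open>Suc a\<close> does
  not.\<close>

lemma sat_end_fms:
  "(\<forall>n. sat (E, s) (end_fms D r d n) v) \<longleftrightarrow> (\<forall>k. has_seg D r d k \<longleftrightarrow> has_seg E s d k)"
proof (cases "\<forall>k. has_seg D r d k")
  case True
  then show ?thesis by (simp add: end_fms_def sat_seg_fm)
next
  case False
  define a where "a = (LEAST k. \<not> has_seg D r d (Suc k))"
  \<comment> \<open>Length 0 always occurs, so a failing length is a successor and the least one can
    be written \<open>Suc a\<close>.\<close>
  have "\<exists>k. \<not> has_seg D r d (Suc k)" using False has_seg_0 by (metis not0_implies_Suc)
  then have a1: "\<not> has_seg D r d (Suc a)" unfolding a_def by (rule LeastI_ex)
  have a0: "has_seg D r d a"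
  proof (cases a)
    case (Suc b)
    then show ?thesis using not_less_Least[of b "\<lambda>k. \<not> has_seg D r d (Suc k)"] by (simp add: a_def)
  qed (simp add: has_seg_0)
  have "(\<forall>n. sat (E, s) (end_fms D r d n) v) \<longleftrightarrow> (\<forall>\<phi>\<in>range (end_fms D r d). sat (E, s) \<phi> v)" by blast
  also have "range (end_fms D r d) = {seg_fm d a, no_seg_fm d (Suc a)}"
    using False by (auto simp: end_fms_def Let_def range_join a_def[symmetric])
  also have "(\<forall>\<phi>\<in>\<dots>. sat (E, s) \<phi> v) \<longleftrightarrow> has_seg E s d a \<and> \<not> has_seg E s d (Suc a)"
    by (simp add: sat_seg_fm sat_no_seg_fm)
  also have "\<dots> \<longleftrightarrow> (\<forall>k. has_seg D r d k \<longleftrightarrow> has_seg E s d k)"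
  proof
    assume E: "has_seg E s d a \<and> \<not> has_seg E s d (Suc a)"
    show "\<forall>k. has_seg D r d k \<longleftrightarrow> has_seg E s d k"
    proof
      fix k
      show "has_seg D r d k \<longleftrightarrow> has_seg E s d k"
      proof (cases "k \<le> a")
        case True
        then show ?thesis using has_seg_mono[OF a0] E has_seg_mono[of E s d a k] by simp
      next
        case False
        then have "Suc a \<le> k" by simp
        then show ?thesis using a1 E has_seg_mono[of D r d k] has_seg_mono[of E s d k] by metis
      qed
    qed
  next
    assume "\<forall>k. has_seg D r d k \<longleftrightarrow> has_seg E s d k"
    then show "has_seg E s d a \<and> \<not> has_seg E s d (Suc a)" using a0 a1 by simp
  qed
  finally show ?thesis .
qed

lemma models_scott_fm:
  "models (E, s) (scott_fm D r) \<longleftrightarrow>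
     lin E s \<and> two_ended E s \<and> (\<forall>d k. has_seg D r d k \<longleftrightarrow> has_seg E s d k)"
proof -
  have "sat (E, s) (scott_fm D r) v \<longleftrightarrow> sat (E, s) lin_fm v \<and> sat (E, s) two_ended_fm v \<and>
    (\<forall>n. sat (E, s) (end_fms D r True n) v) \<and> (\<forall>n. sat (E, s) (end_fms D r False n) v)" for v
  proof -
    have "sat (E, s) (scott_fm D r) v \<longleftrightarrow> (\<forall>\<phi>\<in>range (join (join (\<lambda>_. lin_fm) (\<lambda>_. two_ended_fm))
        (join (end_fms D r True) (end_fms D r False))). sat (E, s) \<phi> v)"
      unfolding scott_fm_def by simp
    then show ?thesis unfolding range_join by auto
  qed
  moreover have all_bool: "(\<forall>d. Q d) \<longleftrightarrow> Q True \<and> Q False" for Q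
    using bool_induct by blast
  ultimately have "sat (E, s) (scott_fm D r) v \<longleftrightarrow>
     lin E s \<and> two_ended E s \<and> (\<forall>d k. has_seg D r d k \<longleftrightarrow> has_seg E s d k)" for v
    unfolding sat_end_fms sat_lin_fm all_bool using sat_two_ended_fm[of E s v] by blast
  then show ?thesis by (simp add: models_def)
qed

text \<open>Positions count from 0, so \<open>j\<close> is the last place of a segment of length
  \<open>Suc j\<close>; below an occupied position all positions are occupied.\<close>

lemma has_seg_Suc_iff: "lin D r \<Longrightarrow> has_seg D r d (Suc j) \<longleftrightarrow> (\<exists>x. pos_at D (at_end d r) j x)"
  unfolding has_seg_def ex_seg_iff[OF lin_at_end]
  using pos_at_down[OF lin_at_end] by (metis less_Suc_eq_le le_refl)

lemma models_scott_fm_isomorphic: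
  assumes "lin D r" "two_ended D r" "infinite D" "models (E, s) (scott_fm D r)"
  shows "isomorphic (D, r) (E, s)"
  using assms positions_isomorphic[of D r E s] unfolding models_scott_fm
  by (metis has_seg_Suc_iff)


section \<open>Simple orders of rank 1\<close>

lemma isomorphic_sym:
  assumes "isomorphic M N"
  shows "isomorphic N M"
proof -
  obtain f where f: "bij_betw f (fst M) (fst N)"
    "\<forall>x\<in>fst M. \<forall>y\<in>fst M. (x, y) \<in> snd M \<longleftrightarrow> (f x, f y) \<in> snd N"
    using assms unfolding isomorphic_def by blast
  have "(x, y) \<in> snd N \<longleftrightarrow> (inv_into (fst M) f x, inv_into (fst M) f y) \<in> snd M"
    if "x \<in> fst N" "y \<in> fst N" for x y
  proof -
    have "inv_into (fst M) f x \<in> fst M" "inv_into (fst M) f y \<in> fst M"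
      "f (inv_into (fst M) f x) = x" "f (inv_into (fst M) f y) = y"
      using f(1) that by (auto simp: bij_betw_def inv_into_into f_inv_into_f)
    then show ?thesis using f(2) by metis
  qed
  then show ?thesis unfolding isomorphic_def using bij_betw_inv_into[OF f(1)] by blast
qed

text \<open>Scott sentences are tested on structures over the naturals only, so the given order and
  its extension are replaced by such copies.\<close>

lemma isomorphic_nat_struc:
  assumes "countable E"
  obtains N :: "nat struc" where "isomorphic (E, s) N"
proof
  let ?f = "to_nat_on E"
  have inj: "inj_on ?f E" using assms by (rule inj_on_to_nat_on)
  have "(x, y) \<in> s \<longleftrightarrow> (?f x, ?f y) \<in> {(?f x, ?f y) | x y. x \<in> E \<and> y \<in> E \<and> (x, y) \<in> s}"
    if "x \<in> E" "y \<in> E" for x y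
    using that inj by (auto dest: inj_onD)
  then show "isomorphic (E, s) (?f ` E, {(?f x, ?f y) | x y. x \<in> E \<and> y \<in> E \<and> (x, y) \<in> s})"
    unfolding isomorphic_def fst_conv snd_conv using inj_on_imp_bij_betw[OF inj] by blast
qed

lemma scott_sentence_scott_fm:
  assumes "lin D r" "two_ended D r" "infinite D"
  shows "scott_sentence (D, r) (scott_fm D r)"
  unfolding scott_sentence_def
proof (intro conjI allI iffI)
  fix M :: "nat struc"
  assume "isomorphic M (D, r)"
  moreover have "models (D, r) (scott_fm D r)" using assms by (simp add: models_scott_fm)
  ultimately show "models M (scott_fm D r)" using models_iso fv_scott_fm by blast
next
  fix M :: "nat struc"
  assume "models M (scott_fm D r)"
  then show "isomorphic M (D, r)"
    using models_scott_fm_isomorphic[OF assms, of "fst M" "snd M"] isomorphic_sym by simp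
qed (rule fv_scott_fm)

text \<open>A transferring Scott sentence would make the extended order isomorphic to the original.
  To refute this, \<open>scott_fm\<close> serves as the invariant: isomorphisms preserve it, and all
  its models are two-ended.\<close>

lemma not_scott_sentence_transfer:
  assumes D: "lin D r" "two_ended D r" "infinite D" "countable D"
    and transfer: "\<And>(E :: ('a + nat) set) s i. finitely_covers i (D :: 'a set, r) (E, s) \<Longrightarrow> models (D, r) \<psi> \<Longrightarrow> models (E, s) \<psi>"
  shows "\<not> scott_sentence (D, r) \<psi>"
proof
  assume \<psi>: "scott_sentence (D, r) \<psi>"
  obtain i and E :: "('a + nat) set" and s where E: "countable E" "finitely_covers i (D, r) (E, s)" "\<not> two_ended E s"
    using two_ended_ex_finitely_covers[OF D] by blast
  obtain N :: "nat struc" where N: "isomorphic (E, s) N" using isomorphic_nat_struc[OF E(1)] .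
  obtain M :: "nat struc" where M: "isomorphic (D, r) M" using isomorphic_nat_struc[OF D(4)] .
  have fv: "fv \<psi> = {}" using \<psi> by (simp add: scott_sentence_def)
  have "models M \<psi>" using \<psi> isomorphic_sym[OF M] unfolding scott_sentence_def by blast
  then have "models (D, r) \<psi>" using models_iso[OF M fv] by simp
  then have "models N \<psi>" using transfer[OF E(2)] models_iso[OF N fv] by simp
  then have "isomorphic N (D, r)" using \<psi> unfolding scott_sentence_def by blast
  moreover have "models (D, r) (scott_fm D r)" using D by (simp add: models_scott_fm)
  ultimately have "models (E, s) (scott_fm D r)"
    by (simp only: models_iso[OF N fv_scott_fm] models_iso[OF _ fv_scott_fm, of N "(D, r)"])
  with E(3) show False by (simp add: models_scott_fm)
qed

section \<open>Summands of rank 0 and two-endedness\<close>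

lemma HR_0_finite: "HR (0::nat) L \<Longrightarrow> finite (Field L)"
  by (erule HR.cases) (simp_all add: bot_nat_def)

lemma lo_sum_pairE:
  assumes "lo_sum lt A L" "(x, y) \<in> L"
  obtains i j where "i = j \<or> lt i j" "x \<in> Field (A i)" "y \<in> Field (A j)"
proof -
  from assms consider i where "(x, y) \<in> A i" | i j where "lt i j" "x \<in> Field (A i)" "y \<in> Field (A j)"
    by (auto simp: lo_sum_def)
  then show thesis by cases (use that in \<open>metis FieldI1 FieldI2\<close>)+
qed

lemma Field_lo_sum:
  assumes "lo_sum lt A L" "x \<in> Field L"
  shows "\<exists>i. x \<in> Field (A i)"
proof -
  obtain y where "(x, y) \<in> L \<or> (y, x) \<in> L" using assms(2) unfolding Field_def by blast
  then show ?thesis using lo_sum_pairE[OF assms(1)] by metis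
qed

lemma
  assumes L: "lo_sum lt A L" and x: "x \<in> Field (A i)"
  shows lo_sum_le: "(z, x) \<in> L \<Longrightarrow> \<exists>j. (j = i \<or> lt j i) \<and> z \<in> Field (A j)"
    and lo_sum_ge: "(x, z) \<in> L \<Longrightarrow> \<exists>j. (j = i \<or> lt i j) \<and> z \<in> Field (A j)"
proof -
  have same: "j = i" if "x \<in> Field (A j)" for j
    using L x that unfolding lo_sum_def by (metis disjoint_iff)
  show "\<exists>j. (j = i \<or> lt j i) \<and> z \<in> Field (A j)" if "(z, x) \<in> L"
    using lo_sum_pairE[OF L that] same by metis
  show "\<exists>j. (j = i \<or> lt i j) \<and> z \<in> Field (A j)" if "(x, z) \<in> L"
    using lo_sum_pairE[OF L that] same by metis
qed

text \<open>A finite order would have rank 0. The summands have rank below 1, so they are finite,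
  and an element of the omega part has predecessors only in the finitely many summands up to its
  own; dually for the other part.\<close>

lemma simple_two_ended:
  assumes "Linear_order L" "simple_lo (1::nat) L"
  shows "infinite (Field L)" "two_ended (Field L) L"
proof -
  have "\<not> HR (0::nat) L" using assms(2) by (simp add: simple_lo_def has_hausdorff_rank_def)
  then show "infinite (Field L)" 
    using HR.intros(1)[OF assms(1)] unfolding bot_nat_def[symmetric] by blast
  from assms(2) obtain A B L1 L2 and a b :: "nat \<Rightarrow> nat" where L: "lo_sum ((<) :: nat \<Rightarrow> nat \<Rightarrow> bool) A L1"
    "lo_sum ((>) :: nat \<Rightarrow> nat \<Rightarrow> bool) B L2" "lo_plus L1 L2 L"
    and ab: "\<And>i. has_hausdorff_rank (A i) (a i) \<and> a i < 1" "\<And>i. has_hausdorff_rank (B i) (b i) \<and> b i < 1"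
    unfolding simple_lo_def by blast
  have fin: "finite (Field (A i))" "finite (Field (B i))" for i
    using ab[of i] HR_0_finite by (auto simp: has_hausdorff_rank_def)
  have disj: "Field L1 \<inter> Field L2 = {}" and Leq: "L = L1 \<union> L2 \<union> Field L1 \<times> Field L2"
    using L(3) by (auto simp: lo_plus_def)
  show "two_ended (Field L) L" unfolding two_ended_def
  proof
    fix x assume "x \<in> Field L"
    then have "x \<in> Field L1 \<or> x \<in> Field L2" by (auto simp: Leq Field_def)
    then show "finite (below (Field L) L x) \<or> finite (below (Field L) (L\<inverse>) x)"
    proof
      assume x: "x \<in> Field L1"
      then obtain i where i: "x \<in> Field (A i)" using Field_lo_sum[OF L(1)] by blast
      have "(z, x) \<in> L1" if "(z, x) \<in> L" for z using that x disj by (auto simp: Leq Field_def)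
      then have "below (Field L) L x \<subseteq> (\<Union>j\<le>i. Field (A j))"
        using lo_sum_le[OF L(1) i] unfolding below_def by fastforce
      then show ?thesis using fin by (meson finite_UN_I finite_atMost finite_subset)
    next
      assume x: "x \<in> Field L2"
      then obtain i where i: "x \<in> Field (B i)" using Field_lo_sum[OF L(2)] by blast
      have "(x, z) \<in> L2" if "(x, z) \<in> L" for z using that x disj by (auto simp: Leq Field_def)
      \<comment> \<open>The index order is reversed here, so elements above \<open>x\<close> lie in
        summands of index at most \<open>i\<close>.\<close>
      then have "below (Field L) (L\<inverse>) x \<subseteq> (\<Union>j\<le>i. Field (B j))"
        using lo_sum_ge[OF L(2) i] unfolding below_def by fastforce
      then show ?thesis using fin by (meson finite_UN_I finite_atMost finite_subset)
    qed
  qed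
qed

primrec level :: "'o complexity \<Rightarrow> 'o" where
  "level (CSigma \<alpha>) = \<alpha>"
| "level (CPi \<alpha>) = \<alpha>"
| "level (CdSigma \<alpha>) = \<alpha>"

text \<open>Strict comparison of levels fails just below a \<open>CdSigma\<close>; recording this
  exception makes the claim stable under transitivity. Everything below \<open>CPi 3\<close> thus
  has level at most 2.\<close>

lemma lower_complexity_level:
  "lower_complexity c d \<Longrightarrow> level c < level d \<or> level c \<le> level d \<and> (\<exists>\<beta>. d = CdSigma \<beta>)"
  by (induction rule: lower_complexity.induct) auto

theorem theorem3p4:
  fixes L :: "'a rel"
  assumes "Linear_order L" and "countable (Field L)" and "simple_lo (1::nat) L"
  shows "(\<exists>\<phi>. computable_fm \<phi> \<and> Pi_fm (3::nat) \<phi> \<and> scott_sentence (Field L, L) \<phi> \<and>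
              optimal_scott_sentence (Field L, L) (CPi (3::nat)) \<phi>) \<and>
         \<not> (\<exists>\<phi>. Sigma_fm (3::nat) \<phi> \<and> scott_sentence (Field L, L) \<phi>) \<and>
         \<not> (\<exists>\<beta>\<le>(2::nat). \<exists>\<phi>. dSigma_fm \<beta> \<phi> \<and> scott_sentence (Field L, L) \<phi>)"
proof -
  let ?\<phi> = "scott_fm (Field L) L"
  note D = lin_Linear_order[OF assms(1)] simple_two_ended(2,1)[OF assms(1,3)]
  have scott: "scott_sentence (Field L, L) ?\<phi>" using D by (rule scott_sentence_scott_fm)
  \<comment> \<open>Levels below 3 are included because optimality asks about them too.\<close>
  have noS: "\<not> scott_sentence (Field L, L) \<psi>" if "Sigma_fm \<beta> \<psi>" "\<beta> \<le> 3" for \<beta> :: nat and \<psi>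
  proof
    assume s: "scott_sentence (Field L, L) \<psi>"
    then have "fv \<psi> = {}" by (simp add: scott_sentence_def)
    from finitely_covers_Sigma3[OF _ that this] not_scott_sentence_transfer[OF D assms(2), of \<psi>] s
    show False unfolding models_def by blast
  qed
  have noP: "\<not> scott_sentence (Field L, L) \<psi>" if "Pi_fm \<beta> \<psi>" "\<beta> \<le> 2" for \<beta> :: nat and \<psi>
  proof
    assume s: "scott_sentence (Field L, L) \<psi>"
    then have "fv \<psi> = {}" by (simp add: scott_sentence_def)
    with finitely_covers_Pi2[OF _ that] not_scott_sentence_transfer[OF D assms(2), of \<psi>] s
    show False unfolding models_def by (metis empty_iff finite.emptyI)
  qed
  have nod: "\<not> scott_sentence (Field L, L) \<psi>" if "dSigma_fm \<beta> \<psi>" "\<beta> \<le> 2" for \<beta> :: nat and \<psi>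
  proof
    assume s: "scott_sentence (Field L, L) \<psi>"
    from that(1) obtain \<psi>1 \<psi>2 where \<psi>: "\<psi> = And \<psi>1 \<psi>2" "Sigma_fm \<beta> \<psi>1" "Pi_fm \<beta> \<psi>2"
      by (auto elim: dSigma_fm.cases)
    have fv: "fv \<psi>1 = {}" "fv \<psi>2 = {}" using s by (auto simp: scott_sentence_def \<psi>)
    \<comment> \<open>The two conjuncts are sentences and are transferred separately.\<close>
    have "models (E, s) \<psi>" if c: "finitely_covers i (Field L, L) (E, s)" and m: "models (Field L, L) \<psi>"
      for E :: "('a + nat) set" and s i
    proof -
      fix v :: "nat \<Rightarrow> 'a"
      have "sat (Field L, L) \<psi>1 v" "sat (Field L, L) \<psi>2 v" using m by (auto simp: models_def \<psi>)
      then have "sat (E, s) \<psi>1 w" "sat (E, s) \<psi>2 w" for w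
        using finitely_covers_Sigma3[OF c \<psi>(2) _ fv(1)] finitely_covers_Pi2[OF c \<psi>(3) \<open>\<beta> \<le> 2\<close>] \<open>\<beta> \<le> 2\<close> fv(2)
        by auto
      then show ?thesis by (simp add: models_def \<psi>)
    qed
    with not_scott_sentence_transfer[OF D assms(2), of \<psi>] s show False by blast
  qed
  have "\<not> (lower_complexity d (CPi (3::nat)) \<and> has_complexity \<psi> d \<and> scott_sentence (Field L, L) \<psi>)" for d \<psi>
    using lower_complexity_level[of d "CPi 3"] noS noP nod by (cases d) auto
  then have "optimal_scott_sentence (Field L, L) (CPi (3::nat)) ?\<phi>"
    using scott Pi_scott_fm by (auto simp: optimal_scott_sentence_def)
  with scott show ?thesis using computable_scott_fm Pi_scott_fm noS nod by blast
qed

end
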